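(* Let $\{X_k;\,k=1,2,\ldots\}$ be a strictly stationary sequence of real random variables and let $p\in[1,2)$ be a fixed real number. Assume $\mathbb{E}|X_1|^p<\infty$ and let $S_n=X_1+\cdots+X_n$, $n=1,2,\ldots$, $S_0=0$. Define the normalizing sequence $\rho_n=\|S_n\|_p/\|W\|_p$, and assume that: (i) for any positive integer $k$ and any real number $x$, $$\lim_{n\to\infty}\Big|\mathbb{E}\exp(ixS_n/\rho_n)-\big(\mathbb{E}\exp(ixS_{[n/k]}/\rho_n)\big)^k\Big|=0;$$ (ii) $\rho_n\to\infty$ and there exists a positive integer $K>1$ such that $\rho_{Kn}/\rho_n\to\sqrt{K}$ as $n\to\infty$; (iii) $\{(|S_n|/\rho_n)^p;\,n=1,2,\ldots\}$ is a uniformly integrable family. Then $S_n/\rho_n$ converges in distribution to $N(0,1)$ as $n\to\infty$.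
   Context: $W$ is a standard normal random variable, $\|X\|_p=(\mathbb{E}|X|^p)^{1/p}$, and $[x]$ denotes the integer part of $x$. *)

theory Defs
  imports "HOL-Probability.Probability"
begin

text \<open>
  The index \<open>0\<close> plays no role below: all sequences \<open>X\<close> are read as \<open>X 1, X 2, \<dots>\<close>.
\<close>

definition strictly_stationary :: "'a measure \<Rightarrow> (nat \<Rightarrow> 'a \<Rightarrow> real) \<Rightarrow> bool" where
  "strictly_stationary M X \<longleftrightarrow>
     (\<forall>k\<ge>1. X k \<in> borel_measurable M) \<and>
     (\<forall>J h. finite J \<and> J \<subseteq> {1..} \<longrightarrow>
        distr M (Pi\<^sub>M J (\<lambda>_. borel)) (\<lambda>\<omega>. \<lambda>j\<in>J. X (j + h) \<omega>) =
        distr M (Pi\<^sub>M J (\<lambda>_. borel)) (\<lambda>\<omega>. \<lambda>j\<in>J. X j \<omega>))"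

definition partial_sum :: "(nat \<Rightarrow> 'a \<Rightarrow> real) \<Rightarrow> nat \<Rightarrow> 'a \<Rightarrow> real" where
  "partial_sum X n \<omega> = (\<Sum>k=1..n. X k \<omega>)"

text \<open>Only meaningful when \<open>\<bar>Y\<bar>\<^sup>p\<close> is integrable (otherwise the value is \<open>0\<close>).\<close>

definition Lp_norm :: "'a measure \<Rightarrow> real \<Rightarrow> ('a \<Rightarrow> real) \<Rightarrow> real" where
  "Lp_norm M p Y = (\<integral>\<omega>. \<bar>Y \<omega>\<bar> powr p \<partial>M) powr (1 / p)"

definition uniformly_integrable ::
    "'a measure \<Rightarrow> 'i set \<Rightarrow> ('i \<Rightarrow> 'a \<Rightarrow> real) \<Rightarrow> bool" where
  "uniformly_integrable M I Y \<longleftrightarrow>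
     (\<forall>i\<in>I. Y i \<in> borel_measurable M) \<and>
     ((\<lambda>a::real. SUP i\<in>I. \<integral>\<^sup>+\<omega>\<in>{\<omega>. a < \<bar>Y i \<omega>\<bar>}. ennreal \<bar>Y i \<omega>\<bar> \<partial>M) \<longlongrightarrow> 0) at_top"

text \<open>
  Convergence in distribution of \<open>Y n\<close> to the law \<open>\<mu>\<close>, in terms of the weak convergence of
  the laws of \<open>Y n\<close>.
\<close>

definition converges_in_distribution ::
    "'a measure \<Rightarrow> (nat \<Rightarrow> 'a \<Rightarrow> real) \<Rightarrow> real measure \<Rightarrow> bool" where
  "converges_in_distribution M Y \<mu> \<longleftrightarrow> weak_conv_m (\<lambda>n. distr M borel (Y n)) \<mu>"

end

theory Submission
  imports Defs
begin

text \<open>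
  Let \<open>A\<close> be the set of weak limits of the laws of \<open>S n / \<rho> n\<close> along sequences of indices tending to
  infinity. By (iii) all \<open>\<nu> \<in> A\<close> have the \<open>p\<close>-th absolute moment of the standard normal law. Writing
  \<open>T \<nu>\<close> for the law of \<open>(Y\<^sub>1 + \<dots> + Y\<^sub>K) / \<surd>K\<close> with \<open>Y\<^sub>i\<close> independent copies of \<open>\<nu>\<close>, conditions (i) for
  \<open>k = K\<close> and (ii) show that \<open>T\<close> maps \<open>A\<close> onto itself.

  Since the laws \<open>T\<^sup>m \<nu>\<close> stay tight, \<open>\<nu>\<close> has mean \<open>0\<close> and finite variance, so \<open>T\<^sup>m \<nu>\<close> tends to a centred
  normal law; comparing \<open>p\<close>-th moments shows that its variance, which is that of \<open>\<nu>\<close>, is \<open>1\<close>. Now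
  write \<open>\<mu> \<in> A\<close> as \<open>T\<^sup>n \<kappa>\<^sub>n\<close> with \<open>\<kappa>\<^sub>n \<in> A\<close>. Any weak limit point of the \<open>\<kappa>\<^sub>n\<close> has variance \<open>1\<close> for the same
  reason, so the squares are uniformly integrable along that subsequence, and Lindeberg's theorem
  shows that \<open>\<mu>\<close> is standard normal.
\<close>

section \<open>Uniform integrability of \<open>p\<close>-th powers, weak limits and
  tightness\<close>

text \<open>Skorohod's representation replaces weak by pointwise convergence, and Fatou's lemma then
  gives the bound, also for unbounded \<open>f\<close>.\<close>

lemma weak_conv_nn_integral_le:
  fixes f :: "real \<Rightarrow> real"
  assumes \<nu>: "\<And>n. real_distribution (\<nu> n)" and \<mu>: "real_distribution \<mu>" and w: "weak_conv_m \<nu> \<mu>"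
    and f: "continuous_on UNIV f" and B: "\<And>n. (\<integral>\<^sup>+x. ennreal (f x) \<partial>\<nu> n) \<le> B"
  shows "(\<integral>\<^sup>+x. ennreal (f x) \<partial>\<mu>) \<le> B"
proof -
  obtain \<Omega> :: "real measure" and Yn :: "nat \<Rightarrow> real \<Rightarrow> real" and Y :: "real \<Rightarrow> real" where
    Yn: "\<And>n. Yn n \<in> measurable \<Omega> borel" "\<And>n. distr \<Omega> borel (Yn n) = \<nu> n"
    and Y: "Y \<in> measurable \<Omega> lborel" "distr \<Omega> borel Y = \<mu>"
    and lim: "\<And>x. x \<in> space \<Omega> \<Longrightarrow> (\<lambda>n. Yn n x) \<longlonglongrightarrow> Y x"
    using Skorohod[OF \<nu> \<mu> w] by blast
  have [measurable]: "f \<in> borel_measurable borel" using f by (rule borel_measurable_continuous_onI)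
  note [measurable] = Yn(1)
  have [measurable]: "Y \<in> borel_measurable \<Omega>" using Y(1) by simp
  have "(\<integral>\<^sup>+x. ennreal (f x) \<partial>\<mu>) = (\<integral>\<^sup>+x. ennreal (f (Y x)) \<partial>\<Omega>)"
    unfolding Y(2)[symmetric] by (subst nn_integral_distr) auto
  also have "\<dots> = (\<integral>\<^sup>+x. liminf (\<lambda>n. ennreal (f (Yn n x))) \<partial>\<Omega>)"
  proof (rule nn_integral_cong)
    fix x assume "x \<in> space \<Omega>"
    have "(\<lambda>n. f (Yn n x)) \<longlonglongrightarrow> f (Y x)"
      using f lim[OF \<open>x \<in> space \<Omega>\<close>] by (auto intro: continuous_on_tendsto_compose)
    then have "(\<lambda>n. ennreal (f (Yn n x))) \<longlonglongrightarrow> ennreal (f (Y x))" by (rule tendsto_ennrealI)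
    then show "ennreal (f (Y x)) = liminf (\<lambda>n. ennreal (f (Yn n x)))"
      by (simp add: lim_imp_Liminf)
  qed
  also have "\<dots> \<le> liminf (\<lambda>n. \<integral>\<^sup>+x. ennreal (f (Yn n x)) \<partial>\<Omega>)"
    by (rule nn_integral_liminf) auto
  also have "(\<lambda>n. \<integral>\<^sup>+x. ennreal (f (Yn n x)) \<partial>\<Omega>) = (\<lambda>n. \<integral>\<^sup>+x. ennreal (f x) \<partial>\<nu> n)"
    unfolding Yn(2)[symmetric] by (subst nn_integral_distr) auto
  also have "liminf \<dots> \<le> B"
    by (rule Liminf_le) (simp_all add: B)
  finally show ?thesis .
qed

text \<open>The identity \<open>f = min f a + max 0 (f - a)\<close> leaves a bounded part, whose
  integral passes to weak limits when \<open>f\<close> is continuous, and a part of integral at most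
  \<open>e\<close>. It is applied with one level \<open>a\<close> for a whole set of laws.\<close>

lemma (in real_distribution) truncation_error:
  fixes f :: "real \<Rightarrow> real"
  assumes [measurable]: "f \<in> borel_measurable borel" and f0: "\<And>x. 0 \<le> f x" and "0 \<le> a"
    and e: "(\<integral>\<^sup>+x. ennreal (f x - a) \<partial>M) \<le> ennreal e" "0 \<le> e"
  shows "integrable M f" "\<bar>(\<integral>x. f x \<partial>M) - (\<integral>x. min (f x) a \<partial>M)\<bar> \<le> e"
proof -
  have i1: "integrable M (\<lambda>x. min (f x) a)"
    by (rule integrable_const_bound[of _ a]) (use f0 \<open>0 \<le> a\<close> in \<open>auto simp: min_def\<close>)
  have "(\<integral>\<^sup>+x. ennreal (max 0 (f x - a)) \<partial>M) \<le> ennreal e"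
    using e(1) by (simp add: max_def ennreal_neg cong: if_cong)
       (smt (verit) ennreal_neg nn_integral_cong)
  then have i2: "integrable M (\<lambda>x. max 0 (f x - a))" and l: "(\<integral>x. max 0 (f x - a) \<partial>M) \<le> e"
    by (auto simp: integrable_iff_bounded integral_eq_nn_integral e(2)
        intro: le_less_trans enn2real_leI)
  have eq: "f = (\<lambda>x. min (f x) a + max 0 (f x - a))" by auto
  have "integrable M (\<lambda>x. min (f x) a + max 0 (f x - a))"
    using i1 i2 by (rule Bochner_Integration.integrable_add)
  with eq show "integrable M f" by simp
  have "(\<integral>x. f x \<partial>M) = (\<integral>x. min (f x) a \<partial>M) + (\<integral>x. max 0 (f x - a) \<partial>M)"
    by (subst eq, rule Bochner_Integration.integral_add[OF i1 i2])
  moreover have "0 \<le> (\<integral>x. max 0 (f x - a) \<partial>M)" by simp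
  ultimately show "\<bar>(\<integral>x. f x \<partial>M) - (\<integral>x. min (f x) a \<partial>M)\<bar> \<le> e" using l by simp
qed

text \<open>
  A set of laws for which \<open>|x|\<^sup>p\<close> is uniformly integrable when \<open>\<epsilon> a \<longlongrightarrow> 0\<close>. The coercion \<open>ennreal\<close>
  cuts \<open>|x|\<^sup>p - a\<close> off at \<open>0\<close>; unlike \<open>|x|\<^sup>p\<close> restricted to \<open>{|x|\<^sup>p > a}\<close>, this is continuous in \<open>x\<close>,
  so that the set is closed under weak limits.
\<close>

definition p_tail :: "real \<Rightarrow> (real \<Rightarrow> ennreal) \<Rightarrow> real measure set" where
  "p_tail p \<epsilon> = {\<nu>. real_distribution \<nu> \<and> (\<forall>a. (\<integral>\<^sup>+x. ennreal (\<bar>x\<bar> powr p - a) \<partial>\<nu>) \<le> \<epsilon> a)}"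

lemma p_tailD:
  assumes "\<nu> \<in> p_tail p \<epsilon>"
  shows "real_distribution \<nu>" "(\<integral>\<^sup>+x. ennreal (\<bar>x\<bar> powr p - a) \<partial>\<nu>) \<le> \<epsilon> a"
  using assms by (auto simp: p_tail_def)

lemma continuous_on_abs_powr: "0 < p \<Longrightarrow> continuous_on UNIV (\<lambda>x::real. \<bar>x\<bar> powr p)"
  by (intro continuous_on_powr' continuous_intros) auto

lemma p_tail_closed:
  assumes p: "0 < p" and \<nu>: "\<And>n. \<nu> n \<in> p_tail p \<epsilon>" and \<mu>: "real_distribution \<mu>" and w: "weak_conv_m \<nu> \<mu>"
  shows "\<mu> \<in> p_tail p \<epsilon>"
proof -
  have "(\<integral>\<^sup>+x. ennreal (\<bar>x\<bar> powr p - a) \<partial>\<mu>) \<le> \<epsilon> a" for a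
    using p_tailD[OF \<nu>] continuous_on_diff[OF continuous_on_abs_powr[OF p] continuous_on_const]
    by (intro weak_conv_nn_integral_le[OF _ \<mu> w])
  with \<mu> show ?thesis by (simp add: p_tail_def)
qed

lemma tail_bound_ex:
  fixes \<epsilon> :: "real \<Rightarrow> ennreal"
  assumes "(\<epsilon> \<longlongrightarrow> 0) at_top" "0 < e"
  shows "\<exists>a\<ge>1. \<epsilon> a \<le> ennreal e"
proof -
  have "eventually (\<lambda>a. \<epsilon> a < ennreal e) at_top"
    using assms by (auto intro: order_tendstoD)
  then have "eventually (\<lambda>a. \<epsilon> a < ennreal e \<and> 1 \<le> a) at_top"
    by (rule eventually_conj[OF _ eventually_ge_at_top])
  then show ?thesis by (auto simp: eventually_at_top_linorder intro!: less_imp_le)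
qed

lemma p_tail_integrable:
  assumes "0 < p" "(\<epsilon> \<longlongrightarrow> 0) at_top" "\<nu> \<in> p_tail p \<epsilon>"
  shows "integrable \<nu> (\<lambda>x. \<bar>x\<bar> powr p)"
proof -
  interpret real_distribution \<nu> using assms p_tailD by blast
  obtain a where "a \<ge> 1" "\<epsilon> a \<le> ennreal 1" using tail_bound_ex[OF assms(2), of 1] by auto
  then show ?thesis
    by (intro truncation_error(1)[where a=a and e=1])
       (auto intro: order_trans[OF p_tailD(2)[OF assms(3)]])
qed

text \<open>Truncation at a level \<open>a\<close> common to all laws costs at most
  \<open>r/4\<close> on either side, and the truncated moments converge because their integrand is
  bounded and continuous.\<close>

lemma p_tail_moment_tendsto:
  assumes p: "0 < p" and \<epsilon>: "(\<epsilon> \<longlongrightarrow> 0) at_top" and \<nu>: "\<And>n. \<nu> n \<in> p_tail p \<epsilon>"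
    and \<mu>: "real_distribution \<mu>" and w: "weak_conv_m \<nu> \<mu>"
  shows "(\<lambda>n. \<integral>x. \<bar>x\<bar> powr p \<partial>\<nu> n) \<longlonglongrightarrow> (\<integral>x. \<bar>x\<bar> powr p \<partial>\<mu>)"
proof (rule LIMSEQ_I)
  fix r :: real assume "0 < r"
  have \<mu>': "\<mu> \<in> p_tail p \<epsilon>" using p_tail_closed[OF p \<nu> \<mu> w] .
  obtain a where a: "a \<ge> 1" "\<epsilon> a \<le> ennreal (r/4)" using tail_bound_ex[OF \<epsilon>, of "r/4"] \<open>0 < r\<close> by auto
  have err: "\<bar>(\<integral>x. \<bar>x\<bar> powr p \<partial>\<kappa>) - (\<integral>x. min (\<bar>x\<bar> powr p) a \<partial>\<kappa>)\<bar> \<le> r/4" if "\<kappa> \<in> p_tail p \<epsilon>" for \<kappa>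
    using a \<open>0 < r\<close>
    by (intro real_distribution.truncation_error(2) p_tailD(1)[OF that])
       (auto intro: order_trans[OF p_tailD(2)[OF that]])
  have "(\<lambda>n. \<integral>x. min (\<bar>x\<bar> powr p) a \<partial>\<nu> n) \<longlonglongrightarrow> (\<integral>x. min (\<bar>x\<bar> powr p) a \<partial>\<mu>)"
  proof (rule weak_conv_imp_integral_bdd_continuous_conv[OF p_tailD(1)[OF \<nu>] \<mu> w, where B=a])
    fix x :: real
    have "isCont (\<lambda>x. \<bar>x\<bar> powr p) x"
      using continuous_on_abs_powr[OF p] by (simp add: continuous_on_eq_continuous_at)
    then show "isCont (\<lambda>x. min (\<bar>x\<bar> powr p) a) x" by (intro continuous_min) auto
    show "norm (min (\<bar>x\<bar> powr p) a) \<le> a" using a by auto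
  qed
  from LIMSEQ_D[OF this, of "r/4"] obtain no where no: "\<And>n. n \<ge> no \<Longrightarrow>
      norm ((\<integral>x. min (\<bar>x\<bar> powr p) a \<partial>\<nu> n) - (\<integral>x. min (\<bar>x\<bar> powr p) a \<partial>\<mu>)) < r/4"
    using \<open>0 < r\<close> by auto
  show "\<exists>no. \<forall>n\<ge>no. norm ((\<integral>x. \<bar>x\<bar> powr p \<partial>\<nu> n) - (\<integral>x. \<bar>x\<bar> powr p \<partial>\<mu>)) < r"
  proof (intro exI allI impI)
    fix n assume "n \<ge> no"
    from no[OF this] err[OF \<nu>, of n] err[OF \<mu>'] \<open>0 < r\<close>
    show "norm ((\<integral>x. \<bar>x\<bar> powr p \<partial>\<nu> n) - (\<integral>x. \<bar>x\<bar> powr p \<partial>\<mu>)) < r"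
      unfolding real_norm_def by linarith
  qed
qed

text \<open>For \<open>p \<ge> 1\<close> and \<open>a \<ge> 1\<close> the excess of |x| over
  \<open>a\<close> is at most that of |x|^p: the two powers compare when |x| is at least 1, and
  otherwise |x| does not exceed \<open>a\<close>. So one truncation level serves all laws and gives
  the bound \<open>a + 1\<close>.\<close>

lemma p_tail_first_moment:
  assumes p: "1 \<le> p" and \<epsilon>: "(\<epsilon> \<longlongrightarrow> 0) at_top"
  obtains C where "0 < C" "\<And>\<nu>. \<nu> \<in> p_tail p \<epsilon> \<Longrightarrow> integrable \<nu> (\<lambda>x. x)"
    "\<And>\<nu>. \<nu> \<in> p_tail p \<epsilon> \<Longrightarrow> (\<integral>x. \<bar>x\<bar> \<partial>\<nu>) \<le> C"
proof -
  obtain a where a: "a \<ge> 1" "\<epsilon> a \<le> ennreal 1" using tail_bound_ex[OF \<epsilon>, of 1] by auto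
  have "integrable \<nu> (\<lambda>x. x) \<and> (\<integral>x. \<bar>x\<bar> \<partial>\<nu>) \<le> a + 1" if \<nu>: "\<nu> \<in> p_tail p \<epsilon>" for \<nu>
  proof -
    interpret real_distribution \<nu> using p_tailD[OF \<nu>] by simp
    have "(\<integral>\<^sup>+x. ennreal (\<bar>x\<bar> - a) \<partial>\<nu>) \<le> (\<integral>\<^sup>+x. ennreal (\<bar>x\<bar> powr p - a) \<partial>\<nu>)"
    proof (rule nn_integral_mono)
      fix x :: real
      show "ennreal (\<bar>x\<bar> - a) \<le> ennreal (\<bar>x\<bar> powr p - a)"
      proof (cases "\<bar>x\<bar> \<ge> 1")
        case True
        then have "\<bar>x\<bar> powr 1 \<le> \<bar>x\<bar> powr p" using p by (intro powr_mono) auto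
        then show ?thesis using True by (intro ennreal_leI) auto
      qed (use a in \<open>auto simp: ennreal_neg\<close>)
    qed
    also have "\<dots> \<le> ennreal 1" using p_tailD(2)[OF \<nu>, of a] a by auto
    finally have t: "(\<integral>\<^sup>+x. ennreal (\<bar>x\<bar> - a) \<partial>\<nu>) \<le> ennreal 1" .
    have i: "integrable \<nu> (\<lambda>x. \<bar>x\<bar>)" and
      "\<bar>(\<integral>x. \<bar>x\<bar> \<partial>\<nu>) - (\<integral>x. min \<bar>x\<bar> a \<partial>\<nu>)\<bar> \<le> 1"
      by (intro truncation_error[OF _ _ _ t]; use a in simp)+
    moreover have "(\<integral>x. min \<bar>x\<bar> a \<partial>\<nu>) \<le> (\<integral>x. a \<partial>\<nu>)"
      using a by (intro integral_mono integrable_const_bound[of _ a]) auto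
    moreover have "(\<integral>x. a \<partial>\<nu>) = a" by (simp del: space_eq_univ add: prob_space)
    ultimately have "(\<integral>x. \<bar>x\<bar> \<partial>\<nu>) \<le> a + 1" by linarith
    moreover have "integrable \<nu> (\<lambda>x. x)"
      by (rule Bochner_Integration.integrable_bound[OF i]) auto
    ultimately show ?thesis by blast
  qed
  then show ?thesis using a by (intro that[of "a+1"]) auto
qed

lemma first_moment_imp_tight:
  assumes \<nu>: "\<And>n. real_distribution (\<nu> n)" and i: "\<And>n. integrable (\<nu> n) (\<lambda>x. x)"
    and C: "\<And>n. (\<integral>x. \<bar>x\<bar> \<partial>\<nu> n) \<le> C"
  shows "tight \<nu>"
  unfolding tight_def
proof (intro conjI allI impI \<nu>)
  fix e :: real assume "0 < e"
  \<comment> \<open>The summand 1 keeps \<open>b\<close> positive when \<open>C = 0\<close> and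
    makes the Markov bound \<open>\<bar>C\<bar> / b\<close> strictly smaller than
    \<open>e\<close>.\<close>
  define b where "b = (\<bar>C\<bar> + 1) / e"
  have b: "0 < b" using \<open>0 < e\<close> by (simp add: b_def)
  show "\<exists>a b. a < b \<and> (\<forall>n. measure (\<nu> n) {a<..b} > 1 - e)"
  proof (intro exI conjI allI)
    show "-b < b" using b by simp
    fix n
    interpret real_distribution "\<nu> n" by fact
    have "measure (\<nu> n) {x\<in>space (\<nu> n). b \<le> \<bar>x\<bar>} \<le> (\<integral>x. \<bar>x\<bar> \<partial>\<nu> n) / b"
      using i[of n] b by (intro integral_Markov_inequality_measure[where A="{}"]) auto
    also have "\<dots> \<le> C / b" using C b by (simp add: divide_right_mono)
    also have "\<dots> \<le> \<bar>C\<bar> / b" using b by (simp add: divide_right_mono)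
    also have "\<dots> < e" using b \<open>0 < e\<close> by (auto simp: b_def field_simps)
    finally have 1: "measure (\<nu> n) {x. b \<le> \<bar>x\<bar>} < e" by simp
    have "1 = measure (\<nu> n) UNIV" using prob_space by simp
    also have "\<dots> \<le> measure (\<nu> n) ({-b<..b} \<union> {x. b \<le> \<bar>x\<bar>})"
      by (intro finite_measure_mono) auto
    also have "\<dots> \<le> measure (\<nu> n) {-b<..b} + measure (\<nu> n) {x. b \<le> \<bar>x\<bar>}"
      by (intro measure_Un_le) auto
    finally show "1 - e < measure (\<nu> n) {-b<..b}" using 1 by simp
  qed
qed

lemma p_tail_tight:
  assumes "1 \<le> p" "(\<epsilon> \<longlongrightarrow> 0) at_top" "\<And>n. \<nu> n \<in> p_tail p \<epsilon>"
  shows "tight \<nu>"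
proof (rule p_tail_first_moment[OF assms(1,2)])
  fix C assume "\<And>\<nu>. \<nu> \<in> p_tail p \<epsilon> \<Longrightarrow> integrable \<nu> (\<lambda>x. x)"
    and "\<And>\<nu>. \<nu> \<in> p_tail p \<epsilon> \<Longrightarrow> (\<integral>x. \<bar>x\<bar> \<partial>\<nu>) \<le> C"
  then show "tight \<nu>"
    by (intro first_moment_imp_tight[of \<nu> C] p_tailD(1)[OF assms(3)]) (simp_all add: assms(3))
qed

text \<open>Tightness gives a convergent subsequence, and the limit inherits the tail bounds because
  these are closed under weak limits.\<close>

lemma p_tail_convergent_subseq:
  assumes p: "1 \<le> p" "(\<epsilon> \<longlongrightarrow> 0) at_top" and \<nu>: "\<And>n. \<nu> n \<in> p_tail p \<epsilon>"
  obtains r \<mu> where "strict_mono (r :: nat \<Rightarrow> nat)" "\<mu> \<in> p_tail p \<epsilon>" "weak_conv_m (\<lambda>n. \<nu> (r n)) \<mu>"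
proof -
  have "tight \<nu>" by (rule p_tail_tight[OF p \<nu>])
  then obtain r \<mu> where r: "strict_mono (r :: nat \<Rightarrow> nat)" "real_distribution \<mu>" "weak_conv_m (\<nu> \<circ> id \<circ> r) \<mu>"
    using tight_imp_convergent_subsubsequence[OF _ strict_mono_id] by blast
  from r(3) have w: "weak_conv_m (\<lambda>n. \<nu> (r n)) \<mu>" by (simp add: comp_def)
  have "\<mu> \<in> p_tail p \<epsilon>"
    by (rule p_tail_closed[OF _ _ r(2) w]) (use \<nu> p in auto)
  with r w show ?thesis by (intro that)
qed

section \<open>Powers of characteristic functions: variance, mean and normal limit\<close>

text \<open>Factoring out \<open>iexp (t * x)\<close> reduces this to the bound |u| for the distance
  of exp(iu) from 1. With \<open>t = 0\<close> it keeps characteristic functions near 1 uniformly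
  over laws with bounded first moments; for general \<open>t\<close> it allows a convergent argument
  to be replaced by its limit.\<close>

lemma (in real_distribution) char_lipschitz:
  assumes i: "integrable M (\<lambda>x. x)"
  shows "norm (char M s - char M t) \<le> \<bar>s - t\<bar> * (\<integral>x. \<bar>x\<bar> \<partial>M)"
proof -
  have I: "integrable M (\<lambda>x. iexp (u * x))" for u
    by (intro integrable_const_bound[of _ 1]) auto
  have "char M s - char M t = (CLINT x|M. iexp (s * x) - iexp (t * x))"
    unfolding char_def by (rule Bochner_Integration.integral_diff[symmetric]; fact)
  also have "norm \<dots> \<le> (\<integral>x. norm (iexp (s * x) - iexp (t * x)) \<partial>M)"
    by (rule integral_norm_bound)
  also have "\<dots> \<le> (\<integral>x. \<bar>s - t\<bar> * \<bar>x\<bar> \<partial>M)"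
  proof (rule integral_mono)
    fix x :: real
    have "iexp (s * x) - iexp (t * x) = iexp (t * x) * (iexp ((s - t) * x) - 1)"
      by (simp add: algebra_simps flip: exp_add)
    then have "norm (iexp (s * x) - iexp (t * x)) = norm (iexp ((s - t) * x) - 1)"
      by (simp add: norm_mult)
    also have "\<dots> \<le> \<bar>(s - t) * x\<bar>" using iexp_approx1[of "(s - t) * x" 0] by simp
    finally show "norm (iexp (s * x) - iexp (t * x)) \<le> \<bar>s - t\<bar> * \<bar>x\<bar>" by (simp add: abs_mult)
  qed (use i Bochner_Integration.integrable_diff[OF I I] in auto)
  also have "\<dots> = \<bar>s - t\<bar> * (\<integral>x. \<bar>x\<bar> \<partial>M)" by simp
  finally show ?thesis .
qed

text \<open>
  If \<open>|\<phi>(\<delta>/\<surd>N)|\<^sup>N\<close> stays away from \<open>0\<close> then \<open>N (1 - |\<phi>(\<delta>/\<surd>N)|\<^sup>2)\<close> is bounded. As the imaginary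
  part of \<open>\<phi>(\<delta>/\<surd>N)\<close> is \<open>O(1/\<surd>N)\<close>, also \<open>N (1 - Re \<phi>(\<delta>/\<surd>N))\<close> is bounded, and Fatou's lemma applies.
\<close>

lemma (in real_distribution) char_power_bounded_below_imp_square_integrable:
  fixes N :: "nat \<Rightarrow> nat"
  assumes i: "integrable M (\<lambda>x. x)" and N: "filterlim N at_top sequentially" and \<delta>: "0 < \<delta>"
    and low: "\<And>m. 1 / 2 \<le> norm (char M (\<delta> / sqrt (N m)) ^ N m)"
  shows "integrable M (\<lambda>x. x\<^sup>2)"
proof -
  define t where "t m = \<delta> / sqrt (N m)" for m
  define C where "C = (\<integral>x. \<bar>x\<bar> \<partial>M)"
  \<comment> \<open>The term \<open>ln 4\<close> comes from squaring the lower bound 1/2, the other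
    one from the imaginary part.\<close>
  define B where "B = ln 4 + \<delta>\<^sup>2 * C\<^sup>2"
  have Nr: "filterlim (\<lambda>m. real (N m)) at_top sequentially"
    by (rule filterlim_compose[OF filterlim_real_sequentially N])
  have t0: "t \<longlonglongrightarrow> 0" unfolding t_def
    by (rule tendsto_divide_0[OF tendsto_const filterlim_at_top_imp_at_infinity])
       (rule filterlim_compose[OF sqrt_at_top Nr])
  have C0: "0 \<le> C" by (simp add: C_def)
  have ii[simp]: "integrable M (\<lambda>x. iexp (u * x))" for u :: real
  proof -
    have "integrable M (\<lambda>x. exp (\<i> * complex_of_real (u * x)))" by (rule integrable_iexp) auto
    then show ?thesis by simp
  qed
  have Re_eq: "Re (char M u) = (\<integral>x. cos (u * x) \<partial>M)" for u
  proof -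
    have "Re (char M u) = (\<integral>x. Re (iexp (u * x)) \<partial>M)"
      unfolding char_def by (rule integral_Re[symmetric]) (rule ii)
    then show ?thesis by (simp add: Re_exp)
  qed
  have icos[simp]: "integrable M (\<lambda>x. cos (u * x))" for u :: real
    by (intro integrable_const_bound[of _ 1]) auto
  have near: "norm (char M u - 1) \<le> \<bar>u\<bar> * C" for u
    using char_lipschitz[OF i, of u 0] by (simp add: char_zero C_def)
  have "(\<lambda>m. \<bar>t m\<bar> * C) \<longlonglongrightarrow> 0" using t0 by (auto intro!: tendsto_eq_intros)
  then have ev1: "eventually (\<lambda>m. \<bar>t m\<bar> * C < 1) sequentially" by (auto intro: order_tendstoD)
  have ev2: "eventually (\<lambda>m. 1 \<le> N m) sequentially" using N by (auto simp: filterlim_at_top)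
  have bound: "eventually (\<lambda>m. N m * (1 - Re (char M (t m))) \<le> B) sequentially"
    using ev1 ev2
  proof eventually_elim
    case (elim m)
    define z where "z = char M (t m)"
    have N0: "0 < real (N m)" using elim by simp
    have z1: "norm (z - 1) < 1" using near[of "t m"] elim by (simp add: z_def)
    \<comment> \<open>For large \<open>m\<close> the value \<open>z\<close> is closer than 1 to 1,
      so its real part is nonnegative; this is what allows \<open>Re z\<close> to be compared with
      its square below.\<close>
    have "\<bar>Re (z - 1)\<bar> < 1" using abs_Re_le_cmod[of "z-1"] z1 by linarith
    then have Rpos: "0 \<le> Re z" by simp
    have "norm z \<le> 1" using cmod_char_le_1 by (simp add: z_def)
    then have R1: "Re z \<le> 1" using complex_Re_le_cmod[of z] by linarith
    have "\<bar>Im (z - 1)\<bar> \<le> \<bar>t m\<bar> * C" using abs_Im_le_cmod[of "z-1"] near[of "t m"] by (simp add: z_def)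
    then have "(Im z)\<^sup>2 \<le> (\<bar>t m\<bar> * C)\<^sup>2" using abs_le_square_iff[of "Im z" "\<bar>t m\<bar> * C"] C0 by (simp add: abs_mult)
    then have I: "N m * (Im z)\<^sup>2 \<le> \<delta>\<^sup>2 * C\<^sup>2"
      using N0 by (simp add: t_def power_mult_distrib power_divide field_simps)
    \<comment> \<open>The inequality \<open>y \<le> exp (y - 1)\<close> for
      \<open>y = (norm z)\<^sup>2\<close> turns the lower bound on the power into an upper bound on
      \<open>N m * (1 - (norm z)\<^sup>2)\<close>.\<close>
    have "1 / 4 \<le> (norm z ^ N m)\<^sup>2"
      using power_mono[OF low[of m], of 2] by (simp add: z_def t_def norm_power power2_eq_square)
    also have "\<dots> = ((norm z)\<^sup>2) ^ N m" by (simp add: power_mult[symmetric] mult.commute)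
    also have "\<dots> \<le> (exp ((norm z)\<^sup>2 - 1)) ^ N m"
      using exp_ge_add_one_self[of "(norm z)\<^sup>2 - 1"] by (intro power_mono) auto
    also have "\<dots> = exp (N m * ((norm z)\<^sup>2 - 1))" by (simp add: exp_of_nat_mult)
    finally have "ln (1 / 4) \<le> N m * ((norm z)\<^sup>2 - 1)" using ln_mono[of "1/4"] by fastforce
    then have A: "N m * (1 - (norm z)\<^sup>2) \<le> ln 4" by (simp add: ln_div algebra_simps)
    have "1 - Re z \<le> 1 - (Re z)\<^sup>2"
      using mult_left_mono[OF R1 Rpos] by (simp add: power2_eq_square)
    also have "\<dots> = (1 - (norm z)\<^sup>2) + (Im z)\<^sup>2" by (simp add: cmod_power2)
    finally have "N m * (1 - Re z) \<le> N m * ((1 - (norm z)\<^sup>2) + (Im z)\<^sup>2)"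
      using N0 by (intro mult_left_mono) auto
    with A I show ?case by (simp add: B_def z_def algebra_simps)
  qed
  \<comment> \<open>Since 1 - cos(2v) = 2 sin(v)^2, the limit reduces to the derivative of sine at
    0.\<close>
  have lim: "(\<lambda>m. N m * (1 - cos (t m * x))) \<longlonglongrightarrow> \<delta>\<^sup>2 / 2 * x\<^sup>2" for x
  proof -
    define c where "c = \<delta> * x / 2"
    have "DERIV (\<lambda>u. sin (c * u)) 0 :> c" by (auto intro!: derivative_eq_intros)
    then have "((\<lambda>u. sin (c * u) / u) \<longlongrightarrow> c) (at 0)" by (simp add: DERIV_def)
    moreover have "filterlim (\<lambda>m. 1 / sqrt (N m)) (at 0) sequentially"
      unfolding filterlim_at
    proof
      show "(\<lambda>m. 1 / sqrt (N m)) \<longlonglongrightarrow> 0"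
        by (rule tendsto_divide_0[OF tendsto_const filterlim_at_top_imp_at_infinity])
           (rule filterlim_compose[OF sqrt_at_top Nr])
      show "eventually (\<lambda>m. 1 / sqrt (N m) \<in> UNIV \<and> 1 / sqrt (N m) \<noteq> 0) sequentially"
        using ev2 by eventually_elim simp
    qed
    ultimately have "(\<lambda>m. sin (c * (1 / sqrt (N m))) / (1 / sqrt (N m))) \<longlonglongrightarrow> c"
      by (rule filterlim_compose)
    then have "(\<lambda>m. 2 * (sin (c * (1 / sqrt (N m))) / (1 / sqrt (N m)))\<^sup>2) \<longlonglongrightarrow> 2 * c\<^sup>2"
      by (intro tendsto_intros)
    moreover have "2 * (sin (c * (1 / sqrt (N m))) / (1 / sqrt (N m)))\<^sup>2 = N m * (1 - cos (t m * x))" for m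
    proof -
      have "t m * x = 2 * (c * (1 / sqrt (N m)))" by (simp add: t_def c_def)
      then show ?thesis by (simp only: cos_double_sin) (simp add: power_mult_distrib power_divide)
    qed
    ultimately have "(\<lambda>m. N m * (1 - cos (t m * x))) \<longlonglongrightarrow> 2 * c\<^sup>2" by (simp only:)
    then show ?thesis by (simp add: c_def power_mult_distrib power_divide)
  qed
  have "(\<integral>\<^sup>+x. ennreal (\<delta>\<^sup>2 / 2 * x\<^sup>2) \<partial>M) = (\<integral>\<^sup>+x. liminf (\<lambda>m. ennreal (N m * (1 - cos (t m * x)))) \<partial>M)"
    by (intro nn_integral_cong lim_imp_Liminf[symmetric] tendsto_ennrealI lim) simp
  also have "\<dots> \<le> liminf (\<lambda>m. \<integral>\<^sup>+x. ennreal (N m * (1 - cos (t m * x))) \<partial>M)"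
    by (rule nn_integral_liminf) auto
  also have "\<dots> = liminf (\<lambda>m. ennreal (N m * (1 - Re (char M (t m)))))"
  proof -
    have "(\<integral>\<^sup>+x. ennreal (N m * (1 - cos (t m * x))) \<partial>M) = ennreal (N m * (1 - Re (char M (t m))))" for m
    proof -
      have "(\<integral>\<^sup>+x. ennreal (N m * (1 - cos (t m * x))) \<partial>M) = ennreal (\<integral>x. N m * (1 - cos (t m * x)) \<partial>M)"
        by (rule nn_integral_eq_integral) auto
      also have "(\<integral>x. N m * (1 - cos (t m * x)) \<partial>M) = N m * (1 - Re (char M (t m)))"
        by (simp add: Re_eq prob_space del: space_eq_univ)
      finally show ?thesis .
    qed
    then show ?thesis by simp
  qed
  also have "\<dots> \<le> ennreal B"
    by (rule Liminf_le) (use bound in \<open>auto intro: ennreal_leI elim: eventually_mono\<close>)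
  finally have "integrable M (\<lambda>x. \<delta>\<^sup>2 / 2 * x\<^sup>2)"
    by (auto simp: integrable_iff_bounded intro: le_less_trans)
  then have "integrable M (\<lambda>x. (2 / \<delta>\<^sup>2) * (\<delta>\<^sup>2 / 2 * x\<^sup>2))"
    by (rule integrable_mult_right)
  then show ?thesis using \<delta> by simp
qed

text \<open>Both terms differ from the same linear polynomial 1 + ita, with \<open>a\<close> the
  mean, by a second-order Taylor remainder.\<close>

lemma (in real_distribution) char_first_order:
  assumes i: "integrable M (\<lambda>x. x)" "integrable M (\<lambda>x. x\<^sup>2)"
  shows "norm (char M t - iexp (t * (\<integral>x. x \<partial>M))) \<le> t\<^sup>2 * ((\<integral>x. x\<^sup>2 \<partial>M) + (\<integral>x. x \<partial>M)\<^sup>2) / 2"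
proof -
  define a where "a = (\<integral>x. x \<partial>M)"
  have taylor: "norm (iexp y - (1 + \<i> * y)) \<le> y\<^sup>2 / 2" for y :: real
    using iexp_approx1[of y 1] by (simp add: eval_nat_numeral)
  have I1: "integrable M (\<lambda>x. exp (\<i> * complex_of_real (t * x)))" by (rule integrable_iexp) auto
  have I2: "integrable M (\<lambda>x. 1 + \<i> * complex_of_real (t * x))"
    using i by (auto intro!: integrable_const)
  have "(CLINT x|M. 1 + \<i> * complex_of_real (t * x)) = 1 + \<i> * complex_of_real (t * a)"
    using i unfolding a_def by (subst Bochner_Integration.integral_add) (auto simp: prob_space simp del: space_eq_univ)
  then have "char M t - (1 + \<i> * complex_of_real (t * a))
      = (CLINT x|M. iexp (t * x) - (1 + \<i> * complex_of_real (t * x)))"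
    unfolding char_def by (subst Bochner_Integration.integral_diff[OF I1 I2]) simp
  also have "norm \<dots> \<le> (\<integral>x. norm (iexp (t * x) - (1 + \<i> * complex_of_real (t * x))) \<partial>M)"
    by (rule integral_norm_bound)
  also have "\<dots> \<le> (\<integral>x. t\<^sup>2 / 2 * x\<^sup>2 \<partial>M)"
  proof (rule integral_mono)
    show "integrable M (\<lambda>x. norm (iexp (t * x) - (1 + \<i> * complex_of_real (t * x))))"
      by (intro integrable_norm Bochner_Integration.integrable_diff I1 I2)
    show "integrable M (\<lambda>x. t\<^sup>2 / 2 * x\<^sup>2)" using i by simp
    show "norm (iexp (t * x) - (1 + \<i> * complex_of_real (t * x))) \<le> t\<^sup>2 / 2 * x\<^sup>2" for x
      using taylor[of "t * x"] unfolding power_mult_distrib by simp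
  qed
  also have "\<dots> = t\<^sup>2 / 2 * (\<integral>x. x\<^sup>2 \<partial>M)" by simp
  finally have "norm (char M t - (1 + \<i> * complex_of_real (t * a))) \<le> t\<^sup>2 / 2 * (\<integral>x. x\<^sup>2 \<partial>M)" .
  with taylor[of "t * a"] norm_triangle_ineq4[of "char M t - (1 + \<i> * complex_of_real (t * a))"
      "iexp (t * a) - (1 + \<i> * complex_of_real (t * a))"]
  show ?thesis unfolding a_def[symmetric] by (simp add: power_mult_distrib field_simps)
qed

text \<open>
  By the law of large numbers \<open>\<phi>(y/N)\<^sup>N\<close> tends to \<open>exp(i y a)\<close>, with \<open>a\<close> the mean, whereas the
  hypothesis at \<open>y/\<surd>N\<close> makes it tend to \<open>1\<close>.
\<close>

lemma (in real_distribution) char_power_near_1_imp_mean_zero: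
  fixes N :: "nat \<Rightarrow> nat"
  assumes i: "integrable M (\<lambda>x. x)" "integrable M (\<lambda>x. x\<^sup>2)" and N: "filterlim N at_top sequentially"
    and near: "\<And>m y. norm (char M (y / sqrt (N m)) ^ N m - 1) \<le> \<bar>y\<bar> * C"
  shows "(\<integral>x. x \<partial>M) = 0"
proof (rule ccontr)
  define a where "a = (\<integral>x. x \<partial>M)"
  define s where "s = ((\<integral>x. x\<^sup>2 \<partial>M) + a\<^sup>2) / 2"
  assume "(\<integral>x. x \<partial>M) \<noteq> 0"
  then have a0: "a \<noteq> 0" by (simp add: a_def)
  \<comment> \<open>With this \<open>y\<close> the limit exp(iya) is -1, as far from 1 as
    possible.\<close>
  define y where "y = pi / a"
  have Nr: "filterlim (\<lambda>m. real (N m)) at_top sequentially"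
    by (rule filterlim_compose[OF filterlim_real_sequentially N])
  have ev: "eventually (\<lambda>m. 1 \<le> N m) sequentially" using N by (auto simp: filterlim_at_top)
  have "eventually (\<lambda>m. norm (iexp pi - 1) \<le> \<bar>y\<bar> * C / sqrt (N m) + y\<^sup>2 * s / N m) sequentially"
    using ev
  proof eventually_elim
    case (elim m)
    have N0: "0 < real (N m)" using elim by simp
    have "norm (char M (y / N m) ^ N m - iexp (y / N m * a) ^ N m) \<le> N m * norm (char M (y / N m) - iexp (y / N m * a))"
      by (rule norm_power_diff[OF cmod_char_le_1]) (simp add: norm_exp_i_times)
    also have "\<dots> \<le> N m * ((y / N m)\<^sup>2 * s)"
      using char_first_order[OF i, of "y / N m"] by (intro mult_left_mono) (auto simp: a_def s_def)
    also have "\<dots> = y\<^sup>2 * s / N m" using N0 by (simp add: power2_eq_square)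
    also have "iexp (y / N m * a) ^ N m = iexp pi"
      using N0 a0 by (simp add: exp_of_nat_mult[symmetric] y_def)
    finally have 1: "norm (char M (y / N m) ^ N m - iexp pi) \<le> y\<^sup>2 * s / N m" .
    \<comment> \<open>The hypothesis is used at the shrinking point \<open>y / sqrt (N m)\<close>,
      which brings the power at \<open>y / N m\<close> within O(1/sqrt N) of 1.\<close>
    have "y / sqrt (N m) / sqrt (N m) = y / N m" using N0 by simp
    then have 2: "norm (char M (y / N m) ^ N m - 1) \<le> \<bar>y\<bar> * C / sqrt (N m)"
      using near[of "y / sqrt (N m)" m] N0 by simp
    show ?case
      using 1 2 norm_triangle_ineq4[of "char M (y / N m) ^ N m - 1" "char M (y / N m) ^ N m - iexp pi"]
      by simp
  qed
  moreover have "(\<lambda>m. \<bar>y\<bar> * C / sqrt (N m) + y\<^sup>2 * s / N m) \<longlonglongrightarrow> 0 + 0"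
    by (intro tendsto_add tendsto_divide_0[OF tendsto_const] filterlim_at_top_imp_at_infinity
        Nr filterlim_compose[OF sqrt_at_top Nr])
  ultimately have "norm (iexp pi - 1) \<le> 0 + 0"
    by (intro tendsto_lowerbound[of _ "0 + 0" sequentially "norm (iexp pi - 1)"]) simp_all
  then show False by (simp add: exp_pi_i)
qed

text \<open>
  The weak convergence together with the equality of all second moments, that of the limit included,
  makes the squares uniformly integrable; this yields the Lindeberg condition.
\<close>

lemma char_power_tendsto_normal:
  fixes N :: "nat \<Rightarrow> nat"
  assumes \<nu>: "\<And>n. real_distribution (\<nu> n)" and \<mu>: "real_distribution \<mu>" and w: "weak_conv_m \<nu> \<mu>"
    and N: "filterlim N at_top sequentially"
    and i: "\<And>n. integrable (\<nu> n) (\<lambda>x. x)" "\<And>n. integrable (\<nu> n) (\<lambda>x. x\<^sup>2)" "integrable \<mu> (\<lambda>x. x\<^sup>2)"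
    and mean: "\<And>n. (\<integral>x. x \<partial>\<nu> n) = 0"
    and s: "\<And>n. (\<integral>x. x\<^sup>2 \<partial>\<nu> n) = s" "(\<integral>x. x\<^sup>2 \<partial>\<mu>) = s"
  shows "(\<lambda>n. char (\<nu> n) (t / sqrt (N n)) ^ N n) \<longlonglongrightarrow> complex_of_real (exp (- (s * t\<^sup>2 / 2)))"
proof -
  \<comment> \<open>The error term of \<open>char_approx3\<close>, a Lindeberg quantity: the cubic
    bound is good for small \<open>x\<close>, the quadratic one for large \<open>x\<close>.\<close>
  define R where "R n = (\<integral>x. min (6 * x\<^sup>2) (\<bar>t / sqrt (N n)\<bar> * \<bar>x\<bar> ^ 3) \<partial>\<nu> n)" for n
  have Nr: "filterlim (\<lambda>m. real (N m)) at_top sequentially"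
    by (rule filterlim_compose[OF filterlim_real_sequentially N])
  have s0: "0 \<le> s" unfolding s(2)[symmetric] by simp
  have R0: "R \<longlonglongrightarrow> 0"
  proof (rule LIMSEQ_I)
    fix e :: real assume e: "0 < e"
    interpret \<mu>: real_distribution \<mu> by fact
    have "(\<lambda>k. \<integral>x. min (x\<^sup>2) (real k) \<partial>\<mu>) \<longlonglongrightarrow> (\<integral>x. x\<^sup>2 \<partial>\<mu>)"
    proof (rule integral_dominated_convergence[where w="\<lambda>x. x\<^sup>2"])
      show "AE x in \<mu>. (\<lambda>k. min (x\<^sup>2) (real k)) \<longlonglongrightarrow> x\<^sup>2"
      proof (intro AE_I2)
        fix x :: real
        have "eventually (\<lambda>k. x\<^sup>2 \<le> real k) sequentially"
          using filterlim_real_sequentially by (simp add: filterlim_at_top)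
        then have "eventually (\<lambda>k. min (x\<^sup>2) (real k) = x\<^sup>2) sequentially" by eventually_elim simp
        then show "(\<lambda>k. min (x\<^sup>2) (real k)) \<longlonglongrightarrow> x\<^sup>2" by (rule tendsto_eventually)
      qed
    qed (use i(3) in auto)
    then have "(\<lambda>k. \<integral>x. min (x\<^sup>2) (real k) \<partial>\<mu>) \<longlonglongrightarrow> s" by (simp only: s(2))
    \<comment> \<open>The tolerances add up to \<open>e\<close>: the factor 12 below meets two
      errors of \<open>e / 36\<close>, and the remaining third is spent on the cubic part.\<close>
    then have "eventually (\<lambda>k. dist (\<integral>x. min (x\<^sup>2) (real k) \<partial>\<mu>) s < e / 36) sequentially"
      by (rule tendstoD) (use e in simp)
    then obtain k :: nat where k: "\<bar>(\<integral>x. min (x\<^sup>2) (real k) \<partial>\<mu>) - s\<bar> < e / 36"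
      unfolding dist_real_def by (blast dest: eventually_happens'[OF sequentially_bot])
    have "(\<lambda>n. \<integral>x. min (x\<^sup>2) (real k) \<partial>\<nu> n) \<longlonglongrightarrow> (\<integral>x. min (x\<^sup>2) (real k) \<partial>\<mu>)"
      by (rule weak_conv_imp_integral_bdd_continuous_conv[OF \<nu> \<mu> w, where B="real k"])
         (auto intro!: continuous_intros)
    from LIMSEQ_D[OF this, of "e/36"] obtain n1 where n1:
      "\<And>n. n \<ge> n1 \<Longrightarrow> \<bar>(\<integral>x. min (x\<^sup>2) (real k) \<partial>\<nu> n) - (\<integral>x. min (x\<^sup>2) (real k) \<partial>\<mu>)\<bar> < e / 36"
      using e by auto
    have "(\<lambda>n. \<bar>t / sqrt (N n)\<bar> * sqrt (2 * k) * s) \<longlonglongrightarrow> \<bar>0\<bar> * sqrt (2 * k) * s"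
      by (intro tendsto_mult tendsto_rabs tendsto_const tendsto_divide_0[OF tendsto_const]
          filterlim_at_top_imp_at_infinity filterlim_compose[OF sqrt_at_top Nr])
    from LIMSEQ_D[OF this, of "e/3"] obtain n2 where n2:
      "\<And>n. n \<ge> n2 \<Longrightarrow> \<bar>t / sqrt (N n)\<bar> * sqrt (2 * k) * s < e / 3"
      using e s0 by (auto simp: abs_mult)
    show "\<exists>no. \<forall>n\<ge>no. norm (R n - 0) < e"
    proof (intro exI[of _ "max n1 n2"] allI impI)
      fix n assume n: "max n1 n2 \<le> n"
      interpret \<nu>: real_distribution "\<nu> n" by fact
      have i2: "integrable (\<nu> n) (\<lambda>x. x\<^sup>2)" by (rule i(2))
      define q where "q = \<bar>t / sqrt (N n)\<bar> * sqrt (2 * k)"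
      have q0: "0 \<le> q" by (simp add: q_def)
      have im: "integrable (\<nu> n) (\<lambda>x. min (x\<^sup>2) (real k))"
        by (rule \<nu>.integrable_const_bound[of _ "real k"]) auto
      \<comment> \<open>The range is split at x^2 = 2k. Below it, |x|^3 is at most sqrt(2k) x^2;
        above it, x^2 - k exceeds half of x^2, whence the factor 12.\<close>
      have "R n \<le> (\<integral>x. 12 * (x\<^sup>2 - min (x\<^sup>2) (real k)) + q * x\<^sup>2 \<partial>\<nu> n)"
        unfolding R_def
      proof (rule integral_mono)
        show "integrable (\<nu> n) (\<lambda>x. min (6 * x\<^sup>2) (\<bar>t / sqrt (N n)\<bar> * \<bar>x\<bar> ^ 3))"
          by (rule Bochner_Integration.integrable_bound[where f="\<lambda>x. 6 * x\<^sup>2"]) (use i2 in auto)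
        show "integrable (\<nu> n) (\<lambda>x. 12 * (x\<^sup>2 - min (x\<^sup>2) (real k)) + q * x\<^sup>2)"
          using i2 im by auto
        fix x :: real
        show "min (6 * x\<^sup>2) (\<bar>t / sqrt (N n)\<bar> * \<bar>x\<bar> ^ 3) \<le> 12 * (x\<^sup>2 - min (x\<^sup>2) (real k)) + q * x\<^sup>2"
        proof (cases "x\<^sup>2 \<le> 2 * k")
          case True
          then have "\<bar>x\<bar> \<le> sqrt (2 * k)" using real_le_rsqrt[of "\<bar>x\<bar>"] by simp
          then have "(\<bar>t / sqrt (N n)\<bar> * x\<^sup>2) * \<bar>x\<bar> \<le> (\<bar>t / sqrt (N n)\<bar> * x\<^sup>2) * sqrt (2 * k)"
            by (intro mult_left_mono) auto
          then have "\<bar>t / sqrt (N n)\<bar> * \<bar>x\<bar> ^ 3 \<le> q * x\<^sup>2"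
            by (simp add: q_def power3_eq_cube power2_eq_square mult_ac)
          then show ?thesis by simp
        next
          case False
          moreover have "0 \<le> q * x\<^sup>2" using q0 by simp
          ultimately have "6 * x\<^sup>2 \<le> 12 * (x\<^sup>2 - min (x\<^sup>2) (real k)) + q * x\<^sup>2"
            by (simp add: min_def)
          then show ?thesis by (rule min.coboundedI1)
        qed
      qed
      also have "\<dots> = 12 * (s - (\<integral>x. min (x\<^sup>2) (real k) \<partial>\<nu> n)) + q * s"
        using i2 im by (simp add: s(1))
      also have "\<dots> < e" 
      proof -
        define u where "u = (\<integral>x. min (x\<^sup>2) (real k) \<partial>\<nu> n)"
        define v where "v = (\<integral>x. min (x\<^sup>2) (real k) \<partial>\<mu>)"
        have "\<bar>u - v\<bar> < e / 36" unfolding u_def v_def using n by (intro n1) simp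
        moreover have "q * s < e / 3" unfolding q_def using n by (intro n2) simp
        moreover have "\<bar>v - s\<bar> < e / 36" unfolding v_def by (rule k)
        ultimately have "- (v - s) < e / 36" "- (u - v) < e / 36" "q * s < e / 3"
          using abs_less_iff by blast+
        then have "12 * (s - u) + q * s < e" by simp
        then show ?thesis unfolding u_def .
      qed
      finally have "R n < e" .
      moreover have "0 \<le> R n" unfolding R_def by simp
      ultimately show "norm (R n - 0) < e" by simp
    qed
  qed
  \<comment> \<open>The threshold \<open>s * t\<^sup>2 / 4\<close> places 1 - s t^2 / (2N) in
    [-1, 1], as required for comparing the \<open>N\<close>-th powers.\<close>
  have "eventually (\<lambda>m. max 1 (s * t\<^sup>2 / 4) \<le> real (N m)) sequentially"
    using Nr unfolding filterlim_at_top by blast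
  then have main: "eventually (\<lambda>n. norm (char (\<nu> n) (t / sqrt (N n)) ^ N n
      - complex_of_real ((1 + (- (s * t\<^sup>2 / 2)) / N n) ^ N n)) \<le> t\<^sup>2 / 6 * R n) sequentially"
  proof eventually_elim
    case (elim n)
    interpret \<nu>: real_distribution "\<nu> n" by fact
    have N0: "0 < real (N n)" and N1: "s * t\<^sup>2 / 4 \<le> real (N n)" using elim by auto
    let ?u = "t / sqrt (N n)"
    have u2: "?u\<^sup>2 = t\<^sup>2 / N n" by (simp add: power_divide)
    have st0: "0 \<le> s * t\<^sup>2" using s0 by simp
    have "norm (char (\<nu> n) ?u ^ N n - complex_of_real (1 + (- (s * t\<^sup>2 / 2)) / N n) ^ N n)
        \<le> N n * norm (char (\<nu> n) ?u - complex_of_real (1 + (- (s * t\<^sup>2 / 2)) / N n))"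
    proof (rule norm_power_diff[OF \<nu>.cmod_char_le_1])
      have "\<bar>1 + (- (s * t\<^sup>2 / 2)) / N n\<bar> \<le> 1"
        using N0 N1 st0 by (auto simp: abs_le_iff field_simps)
      then show "norm (complex_of_real (1 + (- (s * t\<^sup>2 / 2)) / N n)) \<le> 1"
        unfolding norm_of_real .
    qed
    also have "\<dots> \<le> N n * (?u\<^sup>2 / 6 * R n)"
    proof (rule mult_left_mono)
      have "1 + (- (s * t\<^sup>2 / 2)) / N n = 1 - ?u\<^sup>2 * s / 2" unfolding u2 by (simp add: field_simps)
      then show "norm (char (\<nu> n) ?u - complex_of_real (1 + (- (s * t\<^sup>2 / 2)) / N n)) \<le> ?u\<^sup>2 / 6 * R n"
        using \<nu>.char_approx3[OF i(1) mean i(2), of s ?u]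
        by (simp only: R_def mean s(1) diff_0_right)
    qed simp
    also have "\<dots> = t\<^sup>2 / 6 * R n" using N0 unfolding u2 by simp
    finally show ?case unfolding of_real_power .
  qed
  have "(\<lambda>n. (1 + (- (s * t\<^sup>2 / 2)) / real (N n)) ^ N n) \<longlonglongrightarrow> exp (- (s * t\<^sup>2 / 2))"
    by (rule filterlim_compose[OF tendsto_exp_limit_sequentially N])
  then have "(\<lambda>n. complex_of_real ((1 + (- (s * t\<^sup>2 / 2)) / N n) ^ N n)) \<longlonglongrightarrow> complex_of_real (exp (- (s * t\<^sup>2 / 2)))"
    by (rule tendsto_of_real)
  moreover have "(\<lambda>n. t\<^sup>2 / 6 * R n) \<longlonglongrightarrow> 0" using tendsto_mult_right_zero[OF R0] .
  ultimately show ?thesis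
    using Lim_transform[OF _ Lim_null_comparison[OF main]] by blast
qed

section \<open>Laws invariant under normalised sums of \<open>K\<close> independent copies\<close>

lemma powr_eq_1_imp: "0 \<le> x \<Longrightarrow> 0 < p \<Longrightarrow> x powr p = 1 \<Longrightarrow> x = 1" for x p :: real
  by (metis powr_eq_one_iff_gen powr_zero_eq_one less_eq_real_def powr_0 zero_neq_one less_irrefl)

lemma filterlim_power_nat_at_top:
  assumes "1 < (K :: nat)"
  shows "filterlim (\<lambda>m. K ^ m) at_top sequentially"
  unfolding filterlim_at_top
proof
  fix Z :: nat
  show "eventually (\<lambda>m. Z \<le> K ^ m) sequentially"
    using eventually_ge_at_top[of Z]
  proof eventually_elim
    case (elim m)
    then show ?case using power_gt_expt[of K m] assms by simp
  qed
qed

text \<open>The whole orbit has first moments bounded by one \<open>C\<close>, so the powers stay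
  within |y| C of 1; this feeds the criteria for finite variance and mean 0. The orbit is only
  required to lie in \<open>p_tail p \<epsilon>\<close>, so that the lemma also applies to weak
  limits of members of an invariant family.\<close>

lemma p_tail_orbit_moments:
  fixes K :: nat
  assumes p: "1 \<le> p" and \<epsilon>: "(\<epsilon> \<longlongrightarrow> 0) at_top" and K: "1 < K"
    and c: "c = (\<integral>x. \<bar>x\<bar> powr p \<partial>std_normal_distribution)" "0 < c"
    and \<nu>: "real_distribution \<nu>"
    and orbit: "\<And>m. \<exists>\<kappa>\<in>p_tail p \<epsilon>. (\<forall>x. char \<kappa> x = char \<nu> (x / sqrt (K ^ m)) ^ (K ^ m))
        \<and> (\<integral>x. \<bar>x\<bar> powr p \<partial>\<kappa>) = c"
  shows "integrable \<nu> (\<lambda>x. x)" "integrable \<nu> (\<lambda>x. x\<^sup>2)" "(\<integral>x. x \<partial>\<nu>) = 0" "(\<integral>x. x\<^sup>2 \<partial>\<nu>) = 1"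
proof -
  interpret \<nu>: real_distribution \<nu> by fact
  obtain \<kappa> where \<kappa>: "\<And>m. \<kappa> m \<in> p_tail p \<epsilon>"
    "\<And>m x. char (\<kappa> m) x = char \<nu> (x / sqrt (K ^ m)) ^ (K ^ m)"
    "\<And>m. (\<integral>x. \<bar>x\<bar> powr p \<partial>\<kappa> m) = c"
    using orbit by metis
  obtain C where C: "0 < C" "\<And>\<nu>. \<nu> \<in> p_tail p \<epsilon> \<Longrightarrow> integrable \<nu> (\<lambda>x. x)"
    "\<And>\<nu>. \<nu> \<in> p_tail p \<epsilon> \<Longrightarrow> (\<integral>x. \<bar>x\<bar> \<partial>\<nu>) \<le> C"
    using p_tail_first_moment[OF p \<epsilon>] by blast
  \<comment> \<open>The orbit at \<open>m = 0\<close> is \<open>\<nu>\<close> itself, which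
    therefore obeys the tail bounds.\<close>
  have "\<kappa> 0 = \<nu>"
    using \<kappa>(2)[of 0] by (intro Levy_uniqueness p_tailD(1)[OF \<kappa>(1)] \<nu>) (auto simp: fun_eq_iff)
  with \<kappa>(1)[of 0] have \<nu>': "\<nu> \<in> p_tail p \<epsilon>" by simp
  show i1: "integrable \<nu> (\<lambda>x. x)" by (rule C(2)[OF \<nu>'])
  have near: "norm (char \<nu> (y / sqrt (K ^ m)) ^ (K ^ m) - 1) \<le> \<bar>y\<bar> * C" for y m
  proof -
    interpret \<kappa>: real_distribution "\<kappa> m" using p_tailD(1)[OF \<kappa>(1)] .
    have "norm (char (\<kappa> m) y - 1) \<le> \<bar>y\<bar> * (\<integral>x. \<bar>x\<bar> \<partial>\<kappa> m)"
      using \<kappa>.char_lipschitz[OF C(2)[OF \<kappa>(1)], of y 0] by (simp add: \<kappa>.char_zero)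
    also have "\<dots> \<le> \<bar>y\<bar> * C" by (intro mult_left_mono C(3) \<kappa>(1)) simp
    finally show ?thesis by (simp only: \<kappa>(2))
  qed
  note N = filterlim_power_nat_at_top[OF K]
  show i2: "integrable \<nu> (\<lambda>x. x\<^sup>2)"
  proof (rule \<nu>.char_power_bounded_below_imp_square_integrable[OF i1 N, of "1 / (2 * C)"])
    fix m
    define z where "z = char \<nu> (1 / (2 * C) / sqrt (K ^ m)) ^ (K ^ m)"
    \<comment> \<open>The point \<open>1 / (2 * C)\<close> is chosen so that |y| C = 1/2.\<close>
    have "norm (z - 1) \<le> 1 / 2" using near[of "1 / (2 * C)" m] C(1) by (simp add: z_def)
    then have "1 / 2 \<le> norm z" using norm_triangle_ineq2[of 1 "1 - z"] by (simp add: norm_minus_commute)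
    then show "1 / 2 \<le> norm (char \<nu> (1 / (2 * C) / sqrt (K ^ m)) ^ (K ^ m))" by (simp only: z_def)
  qed (use C(1) in simp)
  show mean: "(\<integral>x. x \<partial>\<nu>) = 0"
    by (rule \<nu>.char_power_near_1_imp_mean_zero[OF i1 i2 N, of C]) (use near in simp)
  define s where "s = (\<integral>x. x\<^sup>2 \<partial>\<nu>)"
  have s0: "0 \<le> s" by (simp add: s_def)
  \<comment> \<open>The normal limit is used here for the constant sequence \<open>\<nu>\<close>,
    that is, as the classical central limit theorem.\<close>
  have lim: "(\<lambda>m. char (\<kappa> m) t) \<longlonglongrightarrow> complex_of_real (exp (- (s * t\<^sup>2 / 2)))" for t
    unfolding \<kappa>(2)
    by (rule char_power_tendsto_normal[OF \<nu> \<nu> _ N i1 i2 i2 mean s_def[symmetric] s_def[symmetric]])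
       (simp add: weak_conv_m_def weak_conv_def)
  \<comment> \<open>The centred normal law of variance \<open>s\<close>; the degenerate case
    \<open>s = 0\<close>, a point mass at 0, is not yet excluded.\<close>
  define G where "G = distr std_normal_distribution borel (\<lambda>x. sqrt s * x)"
  interpret Z: real_distribution std_normal_distribution by (rule real_dist_normal_dist)
  have [measurable]: "(\<lambda>x. sqrt s * x) \<in> borel_measurable std_normal_distribution" by simp
  have G: "real_distribution G" unfolding G_def by (rule Z.real_distribution_distr) simp
  have "char G t = char std_normal_distribution (sqrt s * t)" for t
    unfolding G_def char_def by (subst integral_distr) (auto simp: mult_ac)
  then have "char G t = complex_of_real (exp (- (s * t\<^sup>2 / 2)))" for t
    using s0 by (simp add: char_std_normal_distribution power_mult_distrib)
  with lim have "weak_conv_m \<kappa> G" by (intro levy_continuity p_tailD(1)[OF \<kappa>(1)] G) simp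
  from p_tail_moment_tendsto[OF _ \<epsilon> \<kappa>(1) G this] p have "(\<lambda>n. c) \<longlonglongrightarrow> (\<integral>x. \<bar>x\<bar> powr p \<partial>G)"
    by (simp add: \<kappa>(3))
  \<comment> \<open>Scaling multiplies the \<open>p\<close>-th moment by
    \<open>sqrt s powr p\<close>; as both moments equal \<open>c > 0\<close>, this factor is
    1.\<close>
  then have "c = (\<integral>x. \<bar>x\<bar> powr p \<partial>G)" by (rule LIMSEQ_unique[OF tendsto_const])
  also have "\<dots> = (\<integral>x. \<bar>sqrt s * x\<bar> powr p \<partial>std_normal_distribution)"
    unfolding G_def by (rule integral_distr) measurable
  also have "\<dots> = (\<integral>x. sqrt s powr p * \<bar>x\<bar> powr p \<partial>std_normal_distribution)"
    using s0 by (simp add: abs_mult powr_mult)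
  also have "\<dots> = sqrt s powr p * c" unfolding c(1) by (rule integral_mult_right_zero)
  finally have "sqrt s powr p = 1" using c(2) by simp
  then have "sqrt s = 1" using powr_eq_1_imp[of "sqrt s" p] s0 p by simp
  then show "(\<integral>x. x\<^sup>2 \<partial>\<nu>) = 1" by (simp add: s_def)
qed

lemma divide_sqrt_power_Suc: "x / sqrt (real K) / sqrt (real (K ^ m)) = x / sqrt (real (K ^ Suc m))"
  by (simp add: real_sqrt_mult)

text \<open>Iterating \<open>up\<close> gives the orbits from which mean and variance are read off;
  iterating \<open>down\<close> presents \<open>\<mu>\<close> as the row sums of a triangular array
  with \<open>K ^ n\<close> equal factors in row \<open>n\<close>.\<close>

lemma p_tail_invariant_family_normal:
  fixes K :: nat
  assumes p: "1 \<le> p" and \<epsilon>: "(\<epsilon> \<longlongrightarrow> 0) at_top" and K: "1 < K"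
    and c: "c = (\<integral>x. \<bar>x\<bar> powr p \<partial>std_normal_distribution)" "0 < c"
    and A: "A \<subseteq> p_tail p \<epsilon>" and moment: "\<And>\<nu>. \<nu> \<in> A \<Longrightarrow> (\<integral>x. \<bar>x\<bar> powr p \<partial>\<nu>) = c"
    and up: "\<And>\<nu>. \<nu> \<in> A \<Longrightarrow> \<exists>\<kappa>\<in>A. \<forall>x. char \<kappa> x = char \<nu> (x / sqrt K) ^ K"
    and down: "\<And>\<nu>. \<nu> \<in> A \<Longrightarrow> \<exists>\<kappa>\<in>A. \<forall>x. char \<nu> x = char \<kappa> (x / sqrt K) ^ K"
    and \<mu>: "\<mu> \<in> A"
  shows "\<mu> = std_normal_distribution"
proof -
  have rd: "real_distribution \<nu>" if "\<nu> \<in> A" for \<nu> using A that p_tailD(1) by blast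
  have ups: "\<exists>\<kappa>\<in>A. \<forall>x. char \<kappa> x = char \<nu> (x / sqrt (K ^ m)) ^ (K ^ m)" if "\<nu> \<in> A" for \<nu> m
  proof (induction m)
    case 0
    show ?case using that by (intro bexI[of _ \<nu>]) auto
  next
    case (Suc m)
    then obtain \<kappa> where \<kappa>: "\<kappa> \<in> A" "\<And>x. char \<kappa> x = char \<nu> (x / sqrt (K ^ m)) ^ (K ^ m)" by blast
    from up[OF \<kappa>(1)] obtain \<kappa>' where \<kappa>': "\<kappa>' \<in> A" "\<And>x. char \<kappa>' x = char \<kappa> (x / sqrt K) ^ K" by blast
    have "char \<kappa>' x = char \<nu> (x / sqrt (K ^ Suc m)) ^ (K ^ Suc m)" for x
      unfolding \<kappa>'(2) \<kappa>(2) divide_sqrt_power_Suc by (simp add: power_mult[symmetric] mult.commute)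
    with \<kappa>'(1) show ?case by blast
  qed
  have downs: "\<exists>\<kappa>\<in>A. \<forall>x. char \<nu> x = char \<kappa> (x / sqrt (K ^ m)) ^ (K ^ m)" if "\<nu> \<in> A" for \<nu> m
  proof (induction m)
    case 0
    show ?case using that by (intro bexI[of _ \<nu>]) auto
  next
    case (Suc m)
    then obtain \<kappa> where \<kappa>: "\<kappa> \<in> A" "\<And>x. char \<nu> x = char \<kappa> (x / sqrt (K ^ m)) ^ (K ^ m)" by blast
    from down[OF \<kappa>(1)] obtain \<kappa>' where \<kappa>': "\<kappa>' \<in> A" "\<And>x. char \<kappa> x = char \<kappa>' (x / sqrt K) ^ K" by blast
    have "char \<nu> x = char \<kappa>' (x / sqrt (K ^ Suc m)) ^ (K ^ Suc m)" for x
      unfolding \<kappa>(2) \<kappa>'(2) divide_sqrt_power_Suc[symmetric]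
      by (simp add: power_mult[symmetric] mult.commute)
    with \<kappa>'(1) show ?case by blast
  qed
  obtain \<kappa> where \<kappa>: "\<And>n. \<kappa> n \<in> A" "\<And>n x. char \<mu> x = char (\<kappa> n) (x / sqrt (K ^ n)) ^ (K ^ n)"
    using downs[OF \<mu>] by metis
  have \<kappa>': "\<And>n. \<kappa> n \<in> p_tail p \<epsilon>" using \<kappa>(1) A by blast
  obtain r \<nu> where r: "strict_mono (r :: nat \<Rightarrow> nat)" and \<nu>: "\<nu> \<in> p_tail p \<epsilon>" "weak_conv_m (\<lambda>n. \<kappa> (r n)) \<nu>"
    by (rule p_tail_convergent_subseq[OF p \<epsilon> \<kappa>'])
  have \<nu>rd: "real_distribution \<nu>" by (rule p_tailD(1)[OF \<nu>(1)])
  \<comment> \<open>Only membership of \<open>\<nu>\<close> in \<open>p_tail p \<epsilon>\<close> is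
    known, so its orbit is obtained by taking limits: the \<open>m\<close>-th images of the
    \<open>\<kappa> (r n)\<close> have a weak limit point, whose characteristic function is the
    required power and whose moment is again \<open>c\<close>.\<close>
  have orbit_\<nu>: "\<exists>\<eta>\<in>p_tail p \<epsilon>. (\<forall>x. char \<eta> x = char \<nu> (x / sqrt (K ^ m)) ^ (K ^ m))
        \<and> (\<integral>x. \<bar>x\<bar> powr p \<partial>\<eta>) = c" for m
  proof -
    have "\<forall>n. \<exists>\<theta>. \<theta> \<in> A \<and> (\<forall>x. char \<theta> x = char (\<kappa> (r n)) (x / sqrt (K ^ m)) ^ (K ^ m))"
      using ups[OF \<kappa>(1)] by blast
    then obtain \<theta> where \<theta>: "\<And>n. \<theta> n \<in> A"
      "\<And>n x. char (\<theta> n) x = char (\<kappa> (r n)) (x / sqrt (K ^ m)) ^ (K ^ m)" by metis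
    have \<theta>': "\<And>n. \<theta> n \<in> p_tail p \<epsilon>" using \<theta>(1) A by blast
    obtain q \<eta> where q: "strict_mono (q :: nat \<Rightarrow> nat)" and \<eta>: "\<eta> \<in> p_tail p \<epsilon>" "weak_conv_m (\<lambda>n. \<theta> (q n)) \<eta>"
      by (rule p_tail_convergent_subseq[OF p \<epsilon> \<theta>'])
    have "char \<eta> x = char \<nu> (x / sqrt (K ^ m)) ^ (K ^ m)" for x
    proof (rule LIMSEQ_unique)
      show "(\<lambda>n. char (\<theta> (q n)) x) \<longlonglongrightarrow> char \<eta> x"
        by (rule levy_continuity1[OF rd[OF \<theta>(1)] p_tailD(1)[OF \<eta>(1)] \<eta>(2)])
      have "(\<lambda>n. char (\<kappa> (r n)) (x / sqrt (K ^ m))) \<longlonglongrightarrow> char \<nu> (x / sqrt (K ^ m))"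
        by (rule levy_continuity1[OF rd[OF \<kappa>(1)] \<nu>rd \<nu>(2)])
      from LIMSEQ_subseq_LIMSEQ[OF this q]
      have "(\<lambda>n. char (\<kappa> (r (q n))) (x / sqrt (K ^ m))) \<longlonglongrightarrow> char \<nu> (x / sqrt (K ^ m))"
        by (simp only: comp_def)
      then show "(\<lambda>n. char (\<theta> (q n)) x) \<longlonglongrightarrow> char \<nu> (x / sqrt (K ^ m)) ^ (K ^ m)"
        unfolding \<theta>(2) by (rule tendsto_power)
    qed
    moreover have "(\<integral>x. \<bar>x\<bar> powr p \<partial>\<eta>) = c"
    proof (rule LIMSEQ_unique)
      show "(\<lambda>n. \<integral>x. \<bar>x\<bar> powr p \<partial>\<theta> (q n)) \<longlonglongrightarrow> (\<integral>x. \<bar>x\<bar> powr p \<partial>\<eta>)"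
        using p by (intro p_tail_moment_tendsto[OF _ \<epsilon> \<theta>' p_tailD(1)[OF \<eta>(1)] \<eta>(2)]) simp
      show "(\<lambda>n. \<integral>x. \<bar>x\<bar> powr p \<partial>\<theta> (q n)) \<longlonglongrightarrow> c" by (simp add: moment[OF \<theta>(1)])
    qed
    ultimately show ?thesis using \<eta>(1) by blast
  qed
  have orbit_A: "\<exists>\<eta>\<in>p_tail p \<epsilon>. (\<forall>x. char \<eta> x = char \<theta> (x / sqrt (K ^ m)) ^ (K ^ m))
        \<and> (\<integral>x. \<bar>x\<bar> powr p \<partial>\<eta>) = c" if "\<theta> \<in> A" for \<theta> m
    using ups[OF that, of m] moment A by blast
  note m\<kappa> = p_tail_orbit_moments[OF p \<epsilon> K c rd[OF \<kappa>(1)] orbit_A[OF \<kappa>(1)]]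
  note m\<nu> = p_tail_orbit_moments[OF p \<epsilon> K c \<nu>rd orbit_\<nu>]
  have N: "filterlim (\<lambda>n. K ^ r n) at_top sequentially"
    by (rule filterlim_compose[OF filterlim_power_nat_at_top[OF K] filterlim_subseq[OF r]])
  \<comment> \<open>One sequence is evaluated twice: each term equals \<open>char \<mu> t\<close>,
    and the triangular array has the standard normal limit.\<close>
  have "char \<mu> t = char std_normal_distribution t" for t
  proof (rule LIMSEQ_unique)
    show "(\<lambda>n. char (\<kappa> (r n)) (t / sqrt (K ^ r n)) ^ (K ^ r n)) \<longlonglongrightarrow> char \<mu> t"
      by (simp only: \<kappa>(2)[symmetric] tendsto_const)
    show "(\<lambda>n. char (\<kappa> (r n)) (t / sqrt (K ^ r n)) ^ (K ^ r n)) \<longlonglongrightarrow> char std_normal_distribution t"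
      using char_power_tendsto_normal[OF rd[OF \<kappa>(1)] \<nu>rd \<nu>(2) N m\<kappa>(1,2) m\<nu>(2) m\<kappa>(3,4) m\<nu>(4), of t]
      by (simp add: char_std_normal_distribution)
  qed
  then show ?thesis by (intro Levy_uniqueness rd[OF \<mu>] real_dist_normal_dist) auto
qed

text \<open>The subsequential limits form an invariant family: \<open>rel\<close> along the indices
  \<open>K * s j\<close> yields an image of the limit along \<open>s\<close>, and along
  \<open>s j\<close> itself a preimage, found as a limit along \<open>s j div K\<close>.\<close>

lemma weak_conv_normal_of_char_relation:
  fixes K :: nat
  assumes p: "1 \<le> p" and \<epsilon>: "(\<epsilon> \<longlongrightarrow> 0) at_top" and K: "1 < K"
    and c: "c = (\<integral>x. \<bar>x\<bar> powr p \<partial>std_normal_distribution)" "0 < c"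
    and \<mu>: "\<And>n. \<mu> n \<in> p_tail p \<epsilon>"
    and moment: "eventually (\<lambda>n. (\<integral>x. \<bar>x\<bar> powr p \<partial>\<mu> n) = c) sequentially"
    and rel: "\<And>x. (\<lambda>n. char (\<mu> n) x - char (\<mu> (n div K)) (x / sqrt K) ^ K) \<longlonglongrightarrow> 0"
  shows "weak_conv_m \<mu> std_normal_distribution"
proof -
  \<comment> \<open>The indices are asked to tend to infinity rather than to increase strictly,
    because \<open>s j div K\<close> may repeat values.\<close>
  define A where "A = {\<nu>. real_distribution \<nu> \<and>
    (\<exists>s. filterlim s at_top sequentially \<and> weak_conv_m (\<lambda>j. \<mu> (s j)) \<nu>)}"
  have rd: "\<And>n. real_distribution (\<mu> n)" using p_tailD(1)[OF \<mu>] .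
  have A_sub: "\<exists>r \<kappa>. strict_mono (r :: nat \<Rightarrow> nat) \<and> \<kappa> \<in> A \<and> (\<forall>x. (\<lambda>j. char (\<mu> (s (r j))) x) \<longlonglongrightarrow> char \<kappa> x)"
    if s: "filterlim s at_top sequentially" for s
  proof -
    obtain r \<kappa> where r: "strict_mono (r :: nat \<Rightarrow> nat)"
      and \<kappa>: "\<kappa> \<in> p_tail p \<epsilon>" "weak_conv_m (\<lambda>n. \<mu> (s (r n))) \<kappa>"
      by (rule p_tail_convergent_subseq[OF p \<epsilon>, of "\<lambda>n. \<mu> (s n)"]) (simp_all add: \<mu>)
    have "filterlim (\<lambda>n. s (r n)) at_top sequentially"
      by (rule filterlim_compose[OF s filterlim_subseq[OF r]])
    then have "\<kappa> \<in> A" using \<kappa> p_tailD(1)[OF \<kappa>(1)] by (auto simp: A_def)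
    moreover have "\<forall>x. (\<lambda>j. char (\<mu> (s (r j))) x) \<longlonglongrightarrow> char \<kappa> x"
      by (intro allI levy_continuity1 rd p_tailD(1)[OF \<kappa>(1)] \<kappa>(2))
    ultimately show ?thesis using r by blast
  qed
  have normal: "\<nu> = std_normal_distribution" if "\<nu> \<in> A" for \<nu>
  proof (rule p_tail_invariant_family_normal[OF p \<epsilon> K c])
    show "A \<subseteq> p_tail p \<epsilon>"
    proof
      fix \<nu> assume "\<nu> \<in> A"
      then obtain s where \<nu>: "real_distribution \<nu>" and w: "weak_conv_m (\<lambda>j. \<mu> (s j)) \<nu>"
        by (auto simp: A_def)
      show "\<nu> \<in> p_tail p \<epsilon>" by (rule p_tail_closed[OF _ \<mu> \<nu> w]) (use p in simp)
    qed
  next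
    fix \<nu> assume "\<nu> \<in> A"
    then obtain s where \<nu>: "real_distribution \<nu>" and s: "filterlim s at_top sequentially"
      and w: "weak_conv_m (\<lambda>j. \<mu> (s j)) \<nu>" by (auto simp: A_def)
    have char: "(\<lambda>j. char (\<mu> (s j)) x) \<longlonglongrightarrow> char \<nu> x" for x
      by (rule levy_continuity1[OF rd \<nu> w])
    have "(\<lambda>j. \<integral>x. \<bar>x\<bar> powr p \<partial>\<mu> (s j)) \<longlonglongrightarrow> (\<integral>x. \<bar>x\<bar> powr p \<partial>\<nu>)"
      by (rule p_tail_moment_tendsto[OF _ \<epsilon> \<mu> \<nu> w]) (use p in simp)
    moreover have "(\<lambda>j. \<integral>x. \<bar>x\<bar> powr p \<partial>\<mu> (s j)) \<longlonglongrightarrow> c"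
      by (rule tendsto_eventually) (rule eventually_compose_filterlim[OF moment s])
    ultimately show "(\<integral>x. \<bar>x\<bar> powr p \<partial>\<nu>) = c" by (rule LIMSEQ_unique)

    \<comment> \<open>Forward image: since \<open>K * s j div K = s j\<close>, the relation
      expresses a limit along \<open>K * s j\<close> through \<open>\<nu>\<close>.\<close>
    have Ks: "filterlim (\<lambda>j. K * s j) at_top sequentially"
      using s
    proof (rule filterlim_at_top_mono)
      show "eventually (\<lambda>j. s j \<le> K * s j) sequentially" using K by simp
    qed
    obtain r \<kappa> where r: "strict_mono (r :: nat \<Rightarrow> nat)" and \<kappa>: "\<kappa> \<in> A"
      "\<And>x. (\<lambda>j. char (\<mu> (K * s (r j))) x) \<longlonglongrightarrow> char \<kappa> x"
      using A_sub[OF Ks] by blast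
    have "char \<kappa> x = char \<nu> (x / sqrt K) ^ K" for x
    proof -
      have "(\<lambda>j. char (\<mu> (K * s (r j))) x - char (\<mu> (K * s (r j) div K)) (x / sqrt K) ^ K) \<longlonglongrightarrow> 0"
        by (rule filterlim_compose[OF rel filterlim_compose[OF Ks filterlim_subseq[OF r]]])
      moreover have "(\<lambda>j. char (\<mu> (K * s (r j))) x - char (\<mu> (K * s (r j) div K)) (x / sqrt K) ^ K)
          \<longlonglongrightarrow> char \<kappa> x - char \<nu> (x / sqrt K) ^ K"
        using K by (auto intro!: tendsto_intros \<kappa> filterlim_compose[OF char filterlim_subseq[OF r]])
      ultimately show ?thesis using LIMSEQ_unique by fastforce
    qed
    with \<kappa>(1) show "\<exists>\<kappa>\<in>A. \<forall>x. char \<kappa> x = char \<nu> (x / sqrt K) ^ K" by blast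

    \<comment> \<open>Preimage: now \<open>\<nu>\<close> stands on the left of the relation, and a
      limit along \<open>s j div K\<close> on the right.\<close>
    have sK: "filterlim (\<lambda>j. s j div K) at_top sequentially"
      unfolding filterlim_at_top
    proof
      fix Z
      have "eventually (\<lambda>j. Z * K \<le> s j) sequentially" using s by (simp add: filterlim_at_top)
      then show "eventually (\<lambda>j. Z \<le> s j div K) sequentially"
        by eventually_elim (use K in \<open>simp add: less_eq_div_iff_mult_less_eq\<close>)
    qed
    obtain r \<kappa> where r: "strict_mono (r :: nat \<Rightarrow> nat)" and \<kappa>: "\<kappa> \<in> A"
      "\<And>x. (\<lambda>j. char (\<mu> (s (r j) div K)) x) \<longlonglongrightarrow> char \<kappa> x"
      using A_sub[OF sK] by blast
    have "char \<nu> x = char \<kappa> (x / sqrt K) ^ K" for x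
    proof -
      have "(\<lambda>j. char (\<mu> (s (r j))) x - char (\<mu> (s (r j) div K)) (x / sqrt K) ^ K) \<longlonglongrightarrow> 0"
        by (rule filterlim_compose[OF rel filterlim_compose[OF s filterlim_subseq[OF r]]])
      moreover have "(\<lambda>j. char (\<mu> (s (r j))) x - char (\<mu> (s (r j) div K)) (x / sqrt K) ^ K)
          \<longlonglongrightarrow> char \<nu> x - char \<kappa> (x / sqrt K) ^ K"
        by (intro tendsto_intros \<kappa> filterlim_compose[OF char filterlim_subseq[OF r]])
      ultimately show ?thesis using LIMSEQ_unique by fastforce
    qed
    with \<kappa>(1) show "\<exists>\<kappa>\<in>A. \<forall>x. char \<nu> x = char \<kappa> (x / sqrt K) ^ K" by blast
  qed (rule that)
  \<comment> \<open>A tight sequence whose subsequential limits all coincide converges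
    weakly.\<close>
  show ?thesis
  proof (rule tight_subseq_weak_converge[OF rd real_dist_normal_dist])
    show "tight \<mu>" by (rule p_tail_tight[OF p \<epsilon> \<mu>])
    fix s :: "nat \<Rightarrow> nat" and \<nu>
    assume s: "strict_mono s" "real_distribution \<nu>" "weak_conv_m (\<mu> \<circ> s) \<nu>"
    then have "\<nu> \<in> A" using filterlim_subseq[OF s(1)] by (auto simp: A_def comp_def)
    then show "weak_conv_m (\<mu> \<circ> s) std_normal_distribution" using normal s(3) by simp
  qed
qed

section \<open>Minkowski's inequality\<close>

text \<open>For positive arguments this is convexity of the power; an argument 0 is treated apart,
  by \<open>w powr p \<le> w\<close> for \<open>0 < w \<le> 1\<close>.\<close>

lemma convex_comb_powr_le:
  fixes x y u v p :: real
  assumes p: "1 \<le> p" and "0 \<le> x" "0 \<le> y" and uv: "0 < u" "0 < v" "u + v = 1"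
  shows "(u * x + v * y) powr p \<le> u * x powr p + v * y powr p"
proof -
  have uv': "u = 1 - v" "v \<le> 1" using uv by auto
  have small: "(w * z) powr p \<le> w * z powr p" if "0 < w" "w \<le> 1" "0 \<le> z" for w z :: real
  proof -
    have "w powr p \<le> w powr 1" using that p by (intro powr_mono') auto
    then show ?thesis using that by (simp add: powr_mult mult_right_mono)
  qed
  consider "x = 0" | "y = 0" | "0 < x" "0 < y" using assms by linarith
  then show ?thesis
  proof cases
    case 1
    then show ?thesis using small[of v y] assms by simp
  next
    case 2
    then show ?thesis using small[of u x] assms by simp
  next
    case 3
    then show ?thesis
      using convex_onD[OF powr_convex[OF p], of v x y] uv(2) uv'
      by (simp add: uv'(1))
  qed
qed

lemma Lp_norm_nonneg: "0 \<le> Lp_norm M p f"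
  by (simp add: Lp_norm_def)

lemma Lp_norm_powr: "0 < p \<Longrightarrow> Lp_norm M p f powr p = (\<integral>\<omega>. \<bar>f \<omega>\<bar> powr p \<partial>M)"
  by (simp add: Lp_norm_def powr_powr)

lemma integrable_abs_add_powr:
  fixes f g :: "'a \<Rightarrow> real"
  assumes p: "0 \<le> p" and [measurable]: "f \<in> borel_measurable M" "g \<in> borel_measurable M"
    and i: "integrable M (\<lambda>\<omega>. \<bar>f \<omega>\<bar> powr p)" "integrable M (\<lambda>\<omega>. \<bar>g \<omega>\<bar> powr p)"
  shows "integrable M (\<lambda>\<omega>. \<bar>f \<omega> + g \<omega>\<bar> powr p)"
proof (rule Bochner_Integration.integrable_bound)
  show "integrable M (\<lambda>\<omega>. 2 powr p * (\<bar>f \<omega>\<bar> powr p + \<bar>g \<omega>\<bar> powr p))" using i by simp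
  show "AE \<omega> in M. norm (\<bar>f \<omega> + g \<omega>\<bar> powr p) \<le> norm (2 powr p * (\<bar>f \<omega>\<bar> powr p + \<bar>g \<omega>\<bar> powr p))"
  proof (rule AE_I2)
    fix \<omega>
    have "\<bar>f \<omega> + g \<omega>\<bar> powr p \<le> (2 * max \<bar>f \<omega>\<bar> \<bar>g \<omega>\<bar>) powr p" using p by (intro powr_mono2) auto
    also have "\<dots> = 2 powr p * max \<bar>f \<omega>\<bar> \<bar>g \<omega>\<bar> powr p" by (simp add: powr_mult)
    also have "\<dots> \<le> 2 powr p * (\<bar>f \<omega>\<bar> powr p + \<bar>g \<omega>\<bar> powr p)"
      by (intro mult_left_mono) (auto simp: max_def)
    finally show "norm (\<bar>f \<omega> + g \<omega>\<bar> powr p) \<le> norm (2 powr p * (\<bar>f \<omega>\<bar> powr p + \<bar>g \<omega>\<bar> powr p))"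
      by simp
  qed
qed simp

text \<open>Convexity is applied to |f|/a and |g|/b with weights a/(a+b) and b/(a+b), where
  \<open>a\<close> and \<open>b\<close> slightly exceed the two norms; integration bounds the
  \<open>p\<close>-th moment of the sum by (a+b)^p.\<close>

lemma Lp_norm_triangle:
  fixes f g :: "'a \<Rightarrow> real"
  assumes p: "1 \<le> p" and m: "f \<in> borel_measurable M" "g \<in> borel_measurable M"
    and i: "integrable M (\<lambda>\<omega>. \<bar>f \<omega>\<bar> powr p)" "integrable M (\<lambda>\<omega>. \<bar>g \<omega>\<bar> powr p)"
  shows "Lp_norm M p (\<lambda>\<omega>. f \<omega> + g \<omega>) \<le> Lp_norm M p f + Lp_norm M p g"
proof (rule field_le_epsilon)
  fix e :: real assume e: "0 < e"
  \<comment> \<open>The slack \<open>e / 2\<close> keeps \<open>a\<close> and \<open>b\<close>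
    positive even when a norm vanishes, so that dividing by them is harmless.\<close>
  define a where "a = Lp_norm M p f + e / 2"
  define b where "b = Lp_norm M p g + e / 2"
  have a: "0 < a" "(\<integral>\<omega>. \<bar>f \<omega>\<bar> powr p \<partial>M) \<le> a powr p"
    using e p Lp_norm_nonneg[of M p f]
    by (auto simp: a_def Lp_norm_powr[symmetric] intro!: powr_mono2 add_nonneg_pos)
  have b: "0 < b" "(\<integral>\<omega>. \<bar>g \<omega>\<bar> powr p \<partial>M) \<le> b powr p"
    using e p Lp_norm_nonneg[of M p g]
    by (auto simp: b_def Lp_norm_powr[symmetric] intro!: powr_mono2 add_nonneg_pos)
  define u where "u = a / (a + b)"
  define v where "v = b / (a + b)"
  have uv: "0 < u" "0 < v" "u + v = 1" using a b by (auto simp: u_def v_def add_divide_distrib[symmetric])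
  have uabv: "(a + b) * u = a" "(a + b) * v = b" using a b by (simp_all add: u_def v_def)
  have "(\<integral>\<omega>. \<bar>f \<omega> + g \<omega>\<bar> powr p \<partial>M)
      \<le> (\<integral>\<omega>. (a + b) powr p * (u / a powr p * \<bar>f \<omega>\<bar> powr p + v / b powr p * \<bar>g \<omega>\<bar> powr p) \<partial>M)"
  proof (rule integral_mono)
    show "integrable M (\<lambda>\<omega>. \<bar>f \<omega> + g \<omega>\<bar> powr p)"
      using p by (intro integrable_abs_add_powr m i) simp
    show "integrable M (\<lambda>\<omega>. (a + b) powr p * (u / a powr p * \<bar>f \<omega>\<bar> powr p + v / b powr p * \<bar>g \<omega>\<bar> powr p))"
      using i by (intro integrable_mult_right Bochner_Integration.integrable_add)
    fix \<omega>
    have ab: "(a + b) * (u * (\<bar>f \<omega>\<bar> / a) + v * (\<bar>g \<omega>\<bar> / b)) = \<bar>f \<omega>\<bar> + \<bar>g \<omega>\<bar>"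
      using a b uabv by (simp only: distrib_left mult.assoc[symmetric]) simp
    have "\<bar>f \<omega> + g \<omega>\<bar> powr p \<le> ((a + b) * (u * (\<bar>f \<omega>\<bar> / a) + v * (\<bar>g \<omega>\<bar> / b))) powr p"
      unfolding ab using p by (intro powr_mono2) auto
    also have "\<dots> = (a + b) powr p * (u * (\<bar>f \<omega>\<bar> / a) + v * (\<bar>g \<omega>\<bar> / b)) powr p"
      by (rule powr_mult)
    also have "\<dots> \<le> (a + b) powr p * (u * (\<bar>f \<omega>\<bar> / a) powr p + v * (\<bar>g \<omega>\<bar> / b) powr p)"
      using a b uv p by (intro mult_left_mono convex_comb_powr_le) auto
    also have "\<dots> = (a + b) powr p * (u / a powr p * \<bar>f \<omega>\<bar> powr p + v / b powr p * \<bar>g \<omega>\<bar> powr p)"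
      using a b by (simp add: powr_divide)
    finally show "\<bar>f \<omega> + g \<omega>\<bar> powr p \<le> \<dots>" .
  qed
  also have "\<dots> = (a + b) powr p * (u / a powr p * (\<integral>\<omega>. \<bar>f \<omega>\<bar> powr p \<partial>M) + v / b powr p * (\<integral>\<omega>. \<bar>g \<omega>\<bar> powr p \<partial>M))"
    using i by simp
  also have "\<dots> \<le> (a + b) powr p * (u / a powr p * a powr p + v / b powr p * b powr p)"
    using a b uv by (intro mult_left_mono add_mono) auto
  also have "\<dots> = (a + b) powr p" using a b uv by simp
  finally have "Lp_norm M p (\<lambda>\<omega>. f \<omega> + g \<omega>) \<le> ((a + b) powr p) powr (1 / p)"
    unfolding Lp_norm_def using p by (intro powr_mono2) auto
  also have "\<dots> = a + b" using a b p by (simp add: powr_powr)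
  finally show "Lp_norm M p (\<lambda>\<omega>. f \<omega> + g \<omega>) \<le> Lp_norm M p f + Lp_norm M p g + e"
    by (simp add: a_def b_def)
qed

section \<open>The stationary sequence: growth of \<open>\<rho>\<close> and the laws of the
  normalised sums\<close>

lemma strictly_stationary_measurable: "strictly_stationary M X \<Longrightarrow> 1 \<le> k \<Longrightarrow> X k \<in> borel_measurable M"
  by (simp add: strictly_stationary_def)

lemma strictly_stationary_distr:
  assumes X: "strictly_stationary M X" and k: "1 \<le> k"
  shows "distr M borel (X k) = distr M borel (X 1)"
proof -
  note [measurable] = strictly_stationary_measurable[OF X]
  have proj: "distr (distr M (Pi\<^sub>M {1::nat} (\<lambda>_. borel)) (\<lambda>\<omega>. \<lambda>j\<in>{1}. X (j + h) \<omega>)) borel (\<lambda>y. y 1)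
      = distr M borel (X (1 + h))" for h
  proof (subst distr_distr)
    show "(\<lambda>y. y 1) \<in> borel_measurable (Pi\<^sub>M {1::nat} (\<lambda>_. borel :: real measure))"
      by (rule measurable_component_singleton) simp
    show "(\<lambda>\<omega>. \<lambda>j\<in>{1}. X (j + h) \<omega>) \<in> measurable M (Pi\<^sub>M {1} (\<lambda>_. borel))"
      by (rule measurable_restrict) simp
  qed (simp add: comp_def)
  \<comment> \<open>Stationarity for the single index 1, shifted by \<open>k - 1\<close>.\<close>
  have "distr M (Pi\<^sub>M {1} (\<lambda>_. borel)) (\<lambda>\<omega>. \<lambda>j\<in>{1}. X (j + (k - 1)) \<omega>) =
        distr M (Pi\<^sub>M {1} (\<lambda>_. borel)) (\<lambda>\<omega>. \<lambda>j\<in>{1}. X j \<omega>)"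
    using X unfolding strictly_stationary_def by simp
  then show ?thesis using proj[of "k - 1"] proj[of 0] k by simp
qed

theorem theorem14:
  fixes M :: "'a measure" and X :: "nat \<Rightarrow> 'a \<Rightarrow> real"
    and N :: "'b measure" and W :: "'b \<Rightarrow> real"
    and p :: real and S :: "nat \<Rightarrow> 'a \<Rightarrow> real" and \<rho> :: "nat \<Rightarrow> real"
  assumes M: "prob_space M"
    and stationary: "strictly_stationary M X"
    and p: "1 \<le> p" "p < 2"
    and moment: "integrable M (\<lambda>\<omega>. \<bar>X 1 \<omega>\<bar> powr p)"
    and N: "prob_space N"
    and W: "distributed N lborel W std_normal_density"
    and S: "S = partial_sum X"
    and \<rho>: "\<rho> = (\<lambda>n. Lp_norm M p (S n) / Lp_norm N p W)"
    and i: "\<And>(k::nat) (x::real). k \<ge> 1 \<Longrightarrow>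
      (\<lambda>n. cmod ((CLINT \<omega>|M. exp (\<i> * of_real x * of_real (S n \<omega> / \<rho> n)))
               - (CLINT \<omega>|M. exp (\<i> * of_real x * of_real (S (n div k) \<omega> / \<rho> n))) ^ k))
        \<longlonglongrightarrow> 0"
    and ii: "filterlim \<rho> at_top sequentially"
      "\<exists>K::nat. K > 1 \<and> (\<lambda>n. \<rho> (K * n) / \<rho> n) \<longlonglongrightarrow> sqrt (real K)"
    and iii: "uniformly_integrable M {1..} (\<lambda>n \<omega>. (\<bar>S n \<omega>\<bar> / \<rho> n) powr p)"
  shows "converges_in_distribution M (\<lambda>n \<omega>. S n \<omega> / \<rho> n) std_normal_distribution"
proof -
  interpret M: prob_space M by fact
  have p0: "0 < p" using p by simp
  obtain K :: nat where K: "1 < K" and ratio: "(\<lambda>n. \<rho> (K * n) / \<rho> n) \<longlonglongrightarrow> sqrt K"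
    using ii(2) by blast
  define w where "w = Lp_norm N p W"
  define c where "c = (\<integral>x. \<bar>x\<bar> powr p \<partial>std_normal_distribution)"
  have "w powr p = (\<integral>\<omega>. \<bar>W \<omega>\<bar> powr p \<partial>N)" using p0 by (simp add: w_def Lp_norm_powr)
  also have "\<dots> = (\<integral>x. std_normal_density x * \<bar>x\<bar> powr p \<partial>lborel)"
    by (rule distributed_integral[OF W, symmetric]) (auto simp: normal_density_nonneg)
  also have "\<dots> = c" unfolding c_def by (subst integral_density) (auto simp: normal_density_nonneg)
  finally have wc: "w powr p = c" .
  have \<rho>_eq: "\<rho> n = Lp_norm M p (S n) / w" for n by (simp add: \<rho> w_def)
  have \<rho>_pos: "eventually (\<lambda>n. 0 < \<rho> n) sequentially"
    using ii(1) by (simp add: filterlim_at_top_dense)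
  \<comment> \<open>Division by zero yields 0, so \<open>w = 0\<close> would make every
    \<open>\<rho> n\<close> vanish, against \<open>\<rho>\<close> tending to infinity.\<close>
  have w: "0 < w"
  proof -
    obtain n where "0 < \<rho> n" using eventually_happens'[OF sequentially_bot \<rho>_pos] by blast
    then have "w \<noteq> 0" by (auto simp: \<rho>_eq)
    then show ?thesis using Lp_norm_nonneg[of N p W] by (simp add: w_def)
  qed
  have c0: "0 < c" using w wc by auto
  have \<rho>_nonneg: "0 \<le> \<rho> n" for n using w by (simp add: \<rho>_eq Lp_norm_nonneg)

  have Xm[measurable]: "X (Suc k) \<in> borel_measurable M" for k
    by (rule strictly_stationary_measurable[OF stationary]) simp
  have S_Suc: "S (Suc n) = (\<lambda>\<omega>. S n \<omega> + X (Suc n) \<omega>)" for n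
    by (auto simp: S partial_sum_def fun_eq_iff)
  have S_0: "S 0 = (\<lambda>\<omega>. 0)" by (auto simp: S partial_sum_def fun_eq_iff)
  have Sm[measurable]: "S n \<in> borel_measurable M" for n
    by (induction n) (auto simp: S_0 S_Suc)
  define D where "D = Lp_norm M p (X 1)"
  have X_int: "integrable M (\<lambda>\<omega>. \<bar>X (Suc k) \<omega>\<bar> powr p)" and X_norm: "Lp_norm M p (X (Suc k)) = D" for k
  proof -
    have d: "distr M borel (X (Suc k)) = distr M borel (X 1)"
      by (rule strictly_stationary_distr[OF stationary]) simp
    have [measurable]: "X 1 \<in> borel_measurable M" using Xm[of 0] by simp
    have "integrable (distr M borel (X 1)) (\<lambda>x. \<bar>x\<bar> powr p)"
      using moment by (subst integrable_distr_eq) auto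
    then show "integrable M (\<lambda>\<omega>. \<bar>X (Suc k) \<omega>\<bar> powr p)"
      unfolding d[symmetric] by (subst (asm) integrable_distr_eq) auto
    have "(\<integral>\<omega>. \<bar>X (Suc k) \<omega>\<bar> powr p \<partial>M) = (\<integral>x. \<bar>x\<bar> powr p \<partial>distr M borel (X (Suc k)))"
      by (subst integral_distr) auto
    also have "\<dots> = (\<integral>\<omega>. \<bar>X 1 \<omega>\<bar> powr p \<partial>M)"
      unfolding d by (subst integral_distr) auto
    finally show "Lp_norm M p (X (Suc k)) = D" by (simp add: Lp_norm_def D_def)
  qed
  have S_int: "integrable M (\<lambda>\<omega>. \<bar>S n \<omega>\<bar> powr p)" for n
  proof (induction n)
    case (Suc n)
    then show ?case unfolding S_Suc using p0 X_int by (intro integrable_abs_add_powr) auto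
  qed (simp add: S_0)
  \<comment> \<open>By stationarity every increment has norm \<open>D\<close>; Minkowski's
    inequality for \<open>S (Suc n) = S n + X (Suc n)\<close> and for the reverse difference bounds
    the change of \<open>\<rho>\<close> in one step.\<close>
  have step: "\<bar>\<rho> (Suc n) - \<rho> n\<bar> \<le> D / w" for n
  proof -
    have "Lp_norm M p (S (Suc n)) \<le> Lp_norm M p (S n) + D"
      unfolding S_Suc X_norm[of n, symmetric] by (intro Lp_norm_triangle p S_int X_int Sm Xm)
    moreover have "Lp_norm M p (\<lambda>\<omega>. S (Suc n) \<omega> + - X (Suc n) \<omega>) \<le> Lp_norm M p (S (Suc n)) + Lp_norm M p (\<lambda>\<omega>. - X (Suc n) \<omega>)"
      using X_int[of n] by (intro Lp_norm_triangle p S_int Sm) auto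
    moreover have "(\<lambda>\<omega>. S (Suc n) \<omega> + - X (Suc n) \<omega>) = S n" by (simp add: S_Suc)
    moreover have "Lp_norm M p (\<lambda>\<omega>. - X (Suc n) \<omega>) = D" using X_norm[of n] by (simp add: Lp_norm_def)
    ultimately have "\<bar>Lp_norm M p (S (Suc n)) - Lp_norm M p (S n)\<bar> \<le> D" by auto
    then have "\<bar>Lp_norm M p (S (Suc n)) - Lp_norm M p (S n)\<bar> / w \<le> D / w" using w by (intro divide_right_mono) auto
    then show ?thesis using w by (simp add: \<rho>_eq diff_divide_distrib[symmetric])
  qed
  have steps: "\<bar>\<rho> (n + j) - \<rho> n\<bar> \<le> j * (D / w)" for n j
  proof (induction j)
    case (Suc j)
    have "\<bar>\<rho> (n + Suc j) - \<rho> n\<bar> \<le> \<bar>\<rho> (Suc (n + j)) - \<rho> (n + j)\<bar> + \<bar>\<rho> (n + j) - \<rho> n\<bar>" by simp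
    also have "\<dots> \<le> D / w + j * (D / w)" by (intro add_mono step Suc.IH)
    finally show ?case by (simp add: algebra_simps)
  qed simp
  have Dw: "0 \<le> D / w" using w by (simp add: D_def Lp_norm_nonneg)

  have divK: "filterlim (\<lambda>n. n div K) at_top sequentially"
    unfolding filterlim_at_top
  proof
    fix Z
    show "eventually (\<lambda>n. Z \<le> n div K) sequentially"
      using eventually_ge_at_top[of "Z * K"]
      by eventually_elim (use K in \<open>simp add: less_eq_div_iff_mult_less_eq\<close>)
  qed
  have \<rho>K: "filterlim (\<lambda>n. \<rho> (n div K)) at_top sequentially"
    by (rule filterlim_compose[OF ii(1) divK])
  have \<rho>K_pos: "eventually (\<lambda>n. 0 < \<rho> (n div K)) sequentially"
    by (rule eventually_compose_filterlim[OF \<rho>_pos divK])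
  \<comment> \<open>Condition (ii) controls \<open>\<rho>\<close> at multiples of \<open>K\<close>
    only. The remainder \<open>n mod K\<close> changes \<open>\<rho>\<close> by at most
    \<open>K * (D / w)\<close>, which is negligible against \<open>\<rho> (n div K)\<close>.\<close>
  have "(\<lambda>n. \<rho> n / \<rho> (n div K) - \<rho> (K * (n div K)) / \<rho> (n div K)) \<longlonglongrightarrow> 0"
  proof (rule Lim_null_comparison)
    show "eventually (\<lambda>n. norm (\<rho> n / \<rho> (n div K) - \<rho> (K * (n div K)) / \<rho> (n div K))
        \<le> K * (D / w) / \<rho> (n div K)) sequentially"
      using \<rho>K_pos
    proof eventually_elim
      case (elim n)
      have "\<bar>\<rho> (K * (n div K) + n mod K) - \<rho> (K * (n div K))\<bar> \<le> (n mod K) * (D / w)" by (rule steps)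
      also have "\<dots> \<le> K * (D / w)" using K Dw by (intro mult_right_mono) auto
      finally have "\<bar>\<rho> n - \<rho> (K * (n div K))\<bar> \<le> K * (D / w)" by simp
      then have "\<bar>\<rho> n - \<rho> (K * (n div K))\<bar> / \<rho> (n div K) \<le> K * (D / w) / \<rho> (n div K)"
        using elim by (intro divide_right_mono) auto
      then show ?case using elim by (simp add: diff_divide_distrib[symmetric])
    qed
    show "(\<lambda>n. K * (D / w) / \<rho> (n div K)) \<longlonglongrightarrow> 0"
      by (rule tendsto_divide_0[OF tendsto_const filterlim_at_top_imp_at_infinity[OF \<rho>K]])
  qed
  from Lim_transform[OF filterlim_compose[OF ratio divK] this]
  have "(\<lambda>n. \<rho> n / \<rho> (n div K)) \<longlonglongrightarrow> sqrt K" .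
  then have "(\<lambda>n. inverse (\<rho> n / \<rho> (n div K))) \<longlonglongrightarrow> inverse (sqrt K)"
    using K by (intro tendsto_inverse) auto
  then have ratioK: "(\<lambda>n. \<rho> (n div K) / \<rho> n) \<longlonglongrightarrow> 1 / sqrt K" by (simp add: inverse_eq_divide)

  define \<mu> where "\<mu> n = distr M borel (\<lambda>\<omega>. S n \<omega> / \<rho> n)" for n
  have rd: "real_distribution (\<mu> n)" for n unfolding \<mu>_def by (rule M.real_distribution_distr) simp
  \<comment> \<open>For \<open>a \<ge> 0\<close> this is the tail function of (iii); the value
    \<open>\<top>\<close> makes the tail condition vacuous for negative \<open>a\<close> and does
    not affect the limit at infinity.\<close>
  define \<epsilon> where "\<epsilon> a = (if 0 \<le> a then
      (SUP n\<in>{1::nat..}. \<integral>\<^sup>+\<omega>\<in>{\<omega>. a < \<bar>(\<bar>S n \<omega>\<bar> / \<rho> n) powr p\<bar>}. ennreal \<bar>(\<bar>S n \<omega>\<bar> / \<rho> n) powr p\<bar> \<partial>M)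
      else \<top>)" for a :: real
  have \<epsilon>0: "(\<epsilon> \<longlongrightarrow> 0) at_top"
  proof (rule Lim_transform_eventually)
    show "((\<lambda>a. SUP n\<in>{1::nat..}. \<integral>\<^sup>+\<omega>\<in>{\<omega>. a < \<bar>(\<bar>S n \<omega>\<bar> / \<rho> n) powr p\<bar>}. ennreal \<bar>(\<bar>S n \<omega>\<bar> / \<rho> n) powr p\<bar> \<partial>M) \<longlongrightarrow> 0) at_top"
      using iii by (simp add: uniformly_integrable_def)
    show "eventually (\<lambda>a. (SUP n\<in>{1::nat..}. \<integral>\<^sup>+\<omega>\<in>{\<omega>. a < \<bar>(\<bar>S n \<omega>\<bar> / \<rho> n) powr p\<bar>}. ennreal \<bar>(\<bar>S n \<omega>\<bar> / \<rho> n) powr p\<bar> \<partial>M) = \<epsilon> a) at_top"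
      using eventually_ge_at_top[of "0::real"] by eventually_elim (simp add: \<epsilon>_def)
  qed
  have \<mu>_tail: "\<mu> n \<in> p_tail p \<epsilon>" for n
  proof -
    have "(\<integral>\<^sup>+x. ennreal (\<bar>x\<bar> powr p - a) \<partial>\<mu> n) \<le> \<epsilon> a" for a
    proof (cases "0 \<le> a")
      case True
      have "(\<integral>\<^sup>+x. ennreal (\<bar>x\<bar> powr p - a) \<partial>\<mu> n) = (\<integral>\<^sup>+\<omega>. ennreal (\<bar>S n \<omega> / \<rho> n\<bar> powr p - a) \<partial>M)"
        unfolding \<mu>_def by (subst nn_integral_distr) auto
      also have "\<dots> \<le> \<epsilon> a"
      \<comment> \<open>The family in (iii) starts at 1; the law of index 0 is concentrated at 0 and
        has no mass above a level \<open>a \<ge> 0\<close>.\<close>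
      proof (cases "n = 0")
        case True
        then show ?thesis using \<open>0 \<le> a\<close> by (simp add: S_0 ennreal_neg)
      next
        case False
        have "(\<integral>\<^sup>+\<omega>. ennreal (\<bar>S n \<omega> / \<rho> n\<bar> powr p - a) \<partial>M)
           \<le> (\<integral>\<^sup>+\<omega>\<in>{\<omega>. a < \<bar>(\<bar>S n \<omega>\<bar> / \<rho> n) powr p\<bar>}. ennreal \<bar>(\<bar>S n \<omega>\<bar> / \<rho> n) powr p\<bar> \<partial>M)"
          using \<rho>_nonneg[of n] \<open>0 \<le> a\<close>
          by (intro nn_integral_mono) (auto simp: indicator_def abs_divide ennreal_neg intro!: ennreal_leI)
        also have "\<dots> \<le> \<epsilon> a"
          using False \<open>0 \<le> a\<close> unfolding \<epsilon>_def by (auto intro!: SUP_upper)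
        finally show ?thesis .
      qed
      finally show ?thesis .
    qed (simp add: \<epsilon>_def)
    with rd show ?thesis by (simp add: p_tail_def)
  qed
  \<comment> \<open>The normalisation by \<open>\<rho> n\<close> gives the \<open>p\<close>-th
    moment exactly the value \<open>w powr p = c\<close> once \<open>\<rho> n > 0\<close>.\<close>
  have \<mu>_moment: "eventually (\<lambda>n. (\<integral>x. \<bar>x\<bar> powr p \<partial>\<mu> n) = c) sequentially"
    using \<rho>_pos
  proof eventually_elim
    case (elim n)
    have "(\<integral>x. \<bar>x\<bar> powr p \<partial>\<mu> n) = (\<integral>\<omega>. \<bar>S n \<omega> / \<rho> n\<bar> powr p \<partial>M)"
      unfolding \<mu>_def by (subst integral_distr) auto
    also have "\<dots> = (\<integral>\<omega>. \<bar>S n \<omega>\<bar> powr p / \<rho> n powr p \<partial>M)"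
      using elim by (simp add: powr_divide abs_divide)
    also have "\<dots> = (\<integral>\<omega>. \<bar>S n \<omega>\<bar> powr p \<partial>M) / \<rho> n powr p" by simp
    also have "\<dots> = (Lp_norm M p (S n) / \<rho> n) powr p"
      using elim p0 by (simp add: powr_divide Lp_norm_nonneg Lp_norm_powr)
    also have "Lp_norm M p (S n) / \<rho> n = w" using elim w by (auto simp: \<rho>_eq)
    finally show ?case by (simp only: wc)
  qed
  obtain C where C: "\<And>\<nu>. \<nu> \<in> p_tail p \<epsilon> \<Longrightarrow> integrable \<nu> (\<lambda>x. x)"
    "\<And>\<nu>. \<nu> \<in> p_tail p \<epsilon> \<Longrightarrow> (\<integral>x. \<bar>x\<bar> \<partial>\<nu>) \<le> C"
    using p_tail_first_moment[OF p(1) \<epsilon>0] by blast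

  \<comment> \<open>\<open>S m / r\<close> is \<open>S m / \<rho> m\<close> scaled by
    \<open>\<rho> m / r\<close>, which moves the change of normalisation into the argument.\<close>
  have char_eq: "(CLINT \<omega>|M. exp (\<i> * of_real x * of_real (S m \<omega> / r))) = char (\<mu> m) (x * (\<rho> m / r))"
    if "\<rho> m \<noteq> 0" for x r m
    unfolding char_def \<mu>_def using that by (subst integral_distr) (auto simp: mult_ac)
  have rel: "(\<lambda>n. char (\<mu> n) x - char (\<mu> (n div K)) (x / sqrt K) ^ K) \<longlonglongrightarrow> 0" for x
  proof -
    have "(\<lambda>n. (CLINT \<omega>|M. exp (\<i> * of_real x * of_real (S n \<omega> / \<rho> n)))
               - (CLINT \<omega>|M. exp (\<i> * of_real x * of_real (S (n div K) \<omega> / \<rho> n))) ^ K) \<longlonglongrightarrow> 0"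
      by (rule tendsto_norm_zero_cancel, rule i) (use K in simp)
    moreover have "eventually (\<lambda>n. (CLINT \<omega>|M. exp (\<i> * of_real x * of_real (S n \<omega> / \<rho> n)))
               - (CLINT \<omega>|M. exp (\<i> * of_real x * of_real (S (n div K) \<omega> / \<rho> n))) ^ K
          = char (\<mu> n) x - char (\<mu> (n div K)) (x * (\<rho> (n div K) / \<rho> n)) ^ K) sequentially"
      using \<rho>_pos \<rho>K_pos
    proof eventually_elim
      case (elim n)
      then have n: "\<rho> n \<noteq> 0" and nK: "\<rho> (n div K) \<noteq> 0" by auto
      show ?case unfolding char_eq[OF n] char_eq[OF nK] using n by simp
    qed
    ultimately have 1: "(\<lambda>n. char (\<mu> n) x - char (\<mu> (n div K)) (x * (\<rho> (n div K) / \<rho> n)) ^ K) \<longlonglongrightarrow> 0"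
      by (rule Lim_transform_eventually)
    \<comment> \<open>The argument tends to \<open>x / sqrt K\<close> while the law also varies with
      \<open>n\<close>; the Lipschitz constants of the characteristic functions are bounded by one
      \<open>C\<close>, so the replacement error vanishes.\<close>
    have 2: "(\<lambda>n. char (\<mu> (n div K)) (x * (\<rho> (n div K) / \<rho> n)) ^ K - char (\<mu> (n div K)) (x / sqrt K) ^ K) \<longlonglongrightarrow> 0"
    proof (rule Lim_null_comparison)
      show "eventually (\<lambda>n. norm (char (\<mu> (n div K)) (x * (\<rho> (n div K) / \<rho> n)) ^ K - char (\<mu> (n div K)) (x / sqrt K) ^ K)
         \<le> K * (\<bar>x * (\<rho> (n div K) / \<rho> n) - x / sqrt K\<bar> * C)) sequentially"
      proof (rule always_eventually, rule allI)
        fix n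
        interpret \<mu>: real_distribution "\<mu> (n div K)" by (rule rd)
        have "norm (char (\<mu> (n div K)) (x * (\<rho> (n div K) / \<rho> n)) ^ K - char (\<mu> (n div K)) (x / sqrt K) ^ K)
           \<le> K * norm (char (\<mu> (n div K)) (x * (\<rho> (n div K) / \<rho> n)) - char (\<mu> (n div K)) (x / sqrt K))"
          by (intro norm_power_diff \<mu>.cmod_char_le_1)
        also have "\<dots> \<le> K * (\<bar>x * (\<rho> (n div K) / \<rho> n) - x / sqrt K\<bar> * (\<integral>x. \<bar>x\<bar> \<partial>\<mu> (n div K)))"
          by (intro mult_left_mono \<mu>.char_lipschitz C(1) \<mu>_tail) simp
        also have "\<dots> \<le> K * (\<bar>x * (\<rho> (n div K) / \<rho> n) - x / sqrt K\<bar> * C)"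
          by (intro mult_left_mono C(2) \<mu>_tail) simp_all
        finally show "norm (char (\<mu> (n div K)) (x * (\<rho> (n div K) / \<rho> n)) ^ K - char (\<mu> (n div K)) (x / sqrt K) ^ K)
           \<le> K * (\<bar>x * (\<rho> (n div K) / \<rho> n) - x / sqrt K\<bar> * C)" .
      qed
      have "(\<lambda>n. K * (\<bar>x * (\<rho> (n div K) / \<rho> n) - x / sqrt K\<bar> * C)) \<longlonglongrightarrow> K * (\<bar>x * (1 / sqrt K) - x / sqrt K\<bar> * C)"
        by (intro tendsto_intros ratioK)
      then show "(\<lambda>n. K * (\<bar>x * (\<rho> (n div K) / \<rho> n) - x / sqrt K\<bar> * C)) \<longlonglongrightarrow> 0" by simp
    qed
    from tendsto_add[OF 1 2] show ?thesis by simp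
  qed
  have "weak_conv_m \<mu> std_normal_distribution"
    by (rule weak_conv_normal_of_char_relation[OF p(1) \<epsilon>0 K c_def c0 \<mu>_tail \<mu>_moment rel])
  then show ?thesis unfolding converges_in_distribution_def \<mu>_def[abs_def] .
qed

end
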